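(* Let $G$ and $H$ be finitely generated groups. Let $z_G$ be a non-trivial central element of $G$ and let $z_H$ be a non-trivial element of $H$. Let $\mathcal{G}=\{g_1,\ldots,g_m\}$ be a finite generating set of $G$ which defines an isolated left ordering $<_G$ of $G$, numbered so that $1<_G g_1<_G\cdots<_G g_m$. Let $\mathcal{H}=\{h_1,\ldots,h_n\}$ be a finite generating set of $H$ which defines an isolated left ordering $<_H$ of $H$, numbered so that $1<_H h_1<_H\cdots<_H h_n$. Assume: [CF(G)] $g_i<_G z_G$ for all $i$; [CF(H)] $h_i<_H z_H$ for all $i$; [INV(H)] $<_H$ is a $z_H$-right invariant ordering. Let $X=G*_{\mathbb{Z}}H=G*_{\langle z_G=z_H\rangle}H$ be the amalgamated free product of $G$ and $H$ over $\mathbb{Z}$ obtained by identifying $z_G$ with $z_H$. For $i=1,\ldots,m$ let $x_i=g_iz_H^{-1}h_1\in X$. Then: (i) The generating set $\{x_1,\ldots,x_m,h_1,\ldots,h_n\}$ of $X$ defines an isolated left ordering $<_X$ of $X$. (ii) The ordering $<_X$ does not depend on the choice of the generating sets $\mathcal{G}$ and $\mathcal{H}$: it depends only on $<_G$, $<_H$, $z_G$, $z_H$. That is, any other finite generating sets $\mathcal{G}'$ of $G$ and $\mathcal{H}'$ of $H$ which define the same orderings $<_G$ and $<_H$ and satisfy the corresponding conditions [CF(G)] and [CF(H)] yield, by the same construction, the same ordering $<_X$. (iii) The natural inclusions $\iota_G:G\to X$ and $\iota_H:H\to X$ are order-preserving homomorphisms (with respect to $<_G$, $<_X$ and $<_H$,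 $<_X$ respectively). (iv) $1<_X x_1<_X\cdots<_X x_m<_X h_1<_X\cdots<_X h_n<_X z_H=z_G$. Moreover, $z=z_G=z_H$ is $<_X$-positive and $<_X$-cofinal, and $<_X$ is a $z$-right invariant ordering. (v) $r(<_X)\le r(<_G)+r(<_H)$. (vi) If $Y$ is a non-trivial proper subgroup of $X$ that is $<_X$-convex, then $Y=\langle x_1\rangle$, the infinite cyclic group generated by $x_1$.
   Context: A left ordering of a group $G$ is a total ordering $<$ on $G$ such that $g<g'$ implies $hg<hg'$ for all $g,g',h\in G$; its positive cone is the sub-semigroup $P(<)=\{g\in G: 1<g\}$, and elements of $P(<)$ are called $<$-positive. The space $\mathrm{LO}(G)$ of left orderings of $G$ carries the topology with open sub-basis $U_g=\{<\ : 1<g\}$, $g\in G$; an isolated ordering is an isolated point of $\mathrm{LO}(G)$. A left ordering whose positive cone is a finitely generated semigroup is isolated. A finite set $\mathcal{G}$ of non-trivial elements of $G$ defines an isolated left ordering $<$ if the positive cone of $<$ is generated by $\mathcal{G}$ as a semigroup. The rank $r(<)$ of an isolated ordering is the minimal cardinality of a generating set of the semigroup $P(<)$ ($\infty$ if it is not finitely generated). For $g\in G$, a left ordering $<$ is $g$-right invariant if $a<b$ implies $ag<bg$ for all $a,b\in G$. An element $g\in G$ is $<$-cofinal if for every $g'\in G$ there exist integers $k,K$ with $g^k<g'<g^K$. A subgroup $Y$ is $<$-convex if $y<g<y'$ with $y,y'\in Y$ implies $g\in Y$. *)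

theory Defs
  imports
    "HOL-Algebra.Elementary_Groups"
    "HOL-Analysis.Function_Topology"
    "HOL-Library.Extended_Nat"
begin

section \<open>Left orderings\<close>

text \<open>A left ordering is represented by the strict relation \<open>{(a, b). a < b}\<close>. It is contained in
  \<open>carrier G \<times> carrier G\<close>, so equality of orderings is equality of relations.\<close>

definition left_ordering :: "('a, 'c) monoid_scheme \<Rightarrow> 'a rel \<Rightarrow> bool" where
  "left_ordering G R \<longleftrightarrow>
     R \<subseteq> carrier G \<times> carrier G \<and> strict_linear_order_on (carrier G) R \<and>
     (\<forall>h\<in>carrier G. \<forall>(a, b)\<in>R. (h \<otimes>\<^bsub>G\<^esub> a, h \<otimes>\<^bsub>G\<^esub> b) \<in> R)"

definition positive_cone :: "('a, 'c) monoid_scheme \<Rightarrow> 'a rel \<Rightarrow> 'a set" where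
  "positive_cone G R = {g \<in> carrier G. (\<one>\<^bsub>G\<^esub>, g) \<in> R}"

text \<open>The space LO(G). The whole space is added to the sub-basis only to make the underlying set
  LO(G) in the case of the trivial group; otherwise the sets \<open>U\<^sub>g\<close> already cover LO(G).\<close>

definition LO_topology :: "('a, 'c) monoid_scheme \<Rightarrow> 'a rel topology" where
  "LO_topology G = topology_generated_by
     (insert {R. left_ordering G R}
        {{R. left_ordering G R \<and> (\<one>\<^bsub>G\<^esub>, g) \<in> R} | g. g \<in> carrier G})"

definition isolated_ordering :: "('a, 'c) monoid_scheme \<Rightarrow> 'a rel \<Rightarrow> bool" where
  "isolated_ordering G R \<longleftrightarrow> left_ordering G R \<and> openin (LO_topology G) {R}"

inductive_set semigroup_generated :: "('a, 'c) monoid_scheme \<Rightarrow> 'a set \<Rightarrow> 'a set"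
  for G and S where
  gen_incl: "s \<in> S \<Longrightarrow> s \<in> semigroup_generated G S"
| gen_mult: "a \<in> semigroup_generated G S \<Longrightarrow> b \<in> semigroup_generated G S
         \<Longrightarrow> a \<otimes>\<^bsub>G\<^esub> b \<in> semigroup_generated G S"

definition defines_isolated_ordering :: "('a, 'c) monoid_scheme \<Rightarrow> 'a set \<Rightarrow> 'a rel \<Rightarrow> bool" where
  "defines_isolated_ordering G S R \<longleftrightarrow>
     finite S \<and> S \<subseteq> carrier G - {\<one>\<^bsub>G\<^esub>} \<and> left_ordering G R \<and>
     positive_cone G R = semigroup_generated G S"

text \<open>The infimum over the empty family is \<open>\<infinity>\<close>.\<close>

definition ordering_rank :: "('a, 'c) monoid_scheme \<Rightarrow> 'a rel \<Rightarrow> enat" where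
  "ordering_rank G R =
     (INF S \<in> {S. finite S \<and> semigroup_generated G S = positive_cone G R}. enat (card S))"

definition right_invariant :: "('a, 'c) monoid_scheme \<Rightarrow> 'a rel \<Rightarrow> 'a \<Rightarrow> bool" where
  "right_invariant G R g \<longleftrightarrow> (\<forall>(a, b)\<in>R. (a \<otimes>\<^bsub>G\<^esub> g, b \<otimes>\<^bsub>G\<^esub> g) \<in> R)"

definition cofinal_elt :: "('a, 'c) monoid_scheme \<Rightarrow> 'a rel \<Rightarrow> 'a \<Rightarrow> bool" where
  "cofinal_elt G R g \<longleftrightarrow>
     (\<forall>g'\<in>carrier G. \<exists>(k::int) (K::int). (g [^]\<^bsub>G\<^esub> k, g') \<in> R \<and> (g', g [^]\<^bsub>G\<^esub> K) \<in> R)"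

definition order_convex :: "('a, 'c) monoid_scheme \<Rightarrow> 'a rel \<Rightarrow> 'a set \<Rightarrow> bool" where
  "order_convex G R Y \<longleftrightarrow>
     (\<forall>y\<in>Y. \<forall>y'\<in>Y. \<forall>g\<in>carrier G. (y, g) \<in> R \<and> (g, y') \<in> R \<longrightarrow> g \<in> Y)"

lemma left_ordering_iff_positive:
  assumes "group G" "left_ordering G R" "a \<in> carrier G" "b \<in> carrier G"
  shows "(a, b) \<in> R \<longleftrightarrow> inv\<^bsub>G\<^esub> a \<otimes>\<^bsub>G\<^esub> b \<in> positive_cone G R"
proof -
  interpret group G by fact
  have inv: "(h \<otimes>\<^bsub>G\<^esub> x, h \<otimes>\<^bsub>G\<^esub> y) \<in> R" if "h \<in> carrier G" "(x, y) \<in> R" for h x y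
    using assms(2) that unfolding left_ordering_def by blast
  show ?thesis
  proof
    assume "(a, b) \<in> R"
    then show "inv\<^bsub>G\<^esub> a \<otimes>\<^bsub>G\<^esub> b \<in> positive_cone G R"
      using inv[of "inv\<^bsub>G\<^esub> a" a b] assms(3,4) by (simp add: positive_cone_def)
  next
    assume "inv\<^bsub>G\<^esub> a \<otimes>\<^bsub>G\<^esub> b \<in> positive_cone G R"
    then show "(a, b) \<in> R"
      using inv[of a "\<one>\<^bsub>G\<^esub>" "inv\<^bsub>G\<^esub> a \<otimes>\<^bsub>G\<^esub> b"] assms(3,4)
      by (simp add: positive_cone_def m_assoc[symmetric])
  qed
qed

lemma defines_isolated_ordering_unique:
  assumes "group G" "defines_isolated_ordering G S R" "defines_isolated_ordering G S R'"
  shows "R = R'"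
proof -
  have *: "left_ordering G R" "left_ordering G R'" "positive_cone G R = positive_cone G R'"
    using assms(2,3) by (simp_all add: defines_isolated_ordering_def)
  then have "R \<subseteq> carrier G \<times> carrier G" "R' \<subseteq> carrier G \<times> carrier G"
    by (simp_all add: left_ordering_def)
  then show ?thesis
    using left_ordering_iff_positive[OF assms(1) *(1)] left_ordering_iff_positive[OF assms(1) *(2)] *(3)
    by auto
qed


section \<open>Amalgamated free products\<close>

text \<open>The amalgamated product of \<open>G\<close> and \<open>H\<close> along homomorphisms \<open>f : C \<rightarrow> G\<close> and \<open>k : C \<rightarrow> H\<close>:
  words in the disjoint union of the two carriers, modulo the congruence generated by the
  multiplication tables of \<open>G\<close> and \<open>H\<close> and by \<open>f c = k c\<close> for \<open>c\<close> in \<open>C\<close>.\<close>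

inductive_set amalg_rel ::
  "('c, 'x) monoid_scheme \<Rightarrow> ('c \<Rightarrow> 'a) \<Rightarrow> ('a, 'y) monoid_scheme \<Rightarrow> ('c \<Rightarrow> 'b) \<Rightarrow>
   ('b, 'w) monoid_scheme \<Rightarrow> (('a + 'b) list) rel"
  for C f G k H where
  word_refl: "w \<in> lists (carrier G <+> carrier H) \<Longrightarrow> (w, w) \<in> amalg_rel C f G k H"
| word_sym: "(u, v) \<in> amalg_rel C f G k H \<Longrightarrow> (v, u) \<in> amalg_rel C f G k H"
| word_trans: "(u, v) \<in> amalg_rel C f G k H \<Longrightarrow> (v, w) \<in> amalg_rel C f G k H
          \<Longrightarrow> (u, w) \<in> amalg_rel C f G k H"
| word_append: "(u, u') \<in> amalg_rel C f G k H \<Longrightarrow> (v, v') \<in> amalg_rel C f G k H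
           \<Longrightarrow> (u @ v, u' @ v') \<in> amalg_rel C f G k H"
| one_left: "([Inl \<one>\<^bsub>G\<^esub>], []) \<in> amalg_rel C f G k H"
| one_right: "([Inr \<one>\<^bsub>H\<^esub>], []) \<in> amalg_rel C f G k H"
| mult_left: "a \<in> carrier G \<Longrightarrow> b \<in> carrier G
              \<Longrightarrow> ([Inl a, Inl b], [Inl (a \<otimes>\<^bsub>G\<^esub> b)]) \<in> amalg_rel C f G k H"
| mult_right: "a \<in> carrier H \<Longrightarrow> b \<in> carrier H
               \<Longrightarrow> ([Inr a, Inr b], [Inr (a \<otimes>\<^bsub>H\<^esub> b)]) \<in> amalg_rel C f G k H"
| glue: "c \<in> carrier C \<Longrightarrow> ([Inl (f c)], [Inr (k c)]) \<in> amalg_rel C f G k H"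

definition amalg ::
  "('c, 'x) monoid_scheme \<Rightarrow> ('c \<Rightarrow> 'a) \<Rightarrow> ('a, 'y) monoid_scheme \<Rightarrow> ('c \<Rightarrow> 'b) \<Rightarrow>
   ('b, 'w) monoid_scheme \<Rightarrow> (('a + 'b) list set) monoid" where
  "amalg C f G k H =
     \<lparr>carrier = lists (carrier G <+> carrier H) // amalg_rel C f G k H,
      monoid.mult = (\<lambda>A B. \<Union>u\<in>A. \<Union>v\<in>B. amalg_rel C f G k H `` {u @ v}),
      one = amalg_rel C f G k H `` {[]}\<rparr>"

definition amalg_inl ::
  "('c, 'x) monoid_scheme \<Rightarrow> ('c \<Rightarrow> 'a) \<Rightarrow> ('a, 'y) monoid_scheme \<Rightarrow> ('c \<Rightarrow> 'b) \<Rightarrow>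
   ('b, 'w) monoid_scheme \<Rightarrow> 'a \<Rightarrow> ('a + 'b) list set" where
  "amalg_inl C f G k H a = amalg_rel C f G k H `` {[Inl a]}"

definition amalg_inr ::
  "('c, 'x) monoid_scheme \<Rightarrow> ('c \<Rightarrow> 'a) \<Rightarrow> ('a, 'y) monoid_scheme \<Rightarrow> ('c \<Rightarrow> 'b) \<Rightarrow>
   ('b, 'w) monoid_scheme \<Rightarrow> 'b \<Rightarrow> ('a + 'b) list set" where
  "amalg_inr C f G k H b = amalg_rel C f G k H `` {[Inr b]}"

text \<open>That this is the amalgamated product is confirmed by the universal property proved below.\<close>

locale amalgam_data = G: group G + H: group H + f: group_hom C G f + k: group_hom C H k
  for C :: "('c, 'x) monoid_scheme" and f :: "'c \<Rightarrow> 'a" and G :: "('a, 'y) monoid_scheme"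
    and k :: "'c \<Rightarrow> 'b" and H :: "('b, 'w) monoid_scheme"
begin

abbreviation "W \<equiv> lists (carrier G <+> carrier H)"
abbreviation "E \<equiv> amalg_rel C f G k H"
abbreviation "X \<equiv> amalg C f G k H"
abbreviation "inl \<equiv> amalg_inl C f G k H"
abbreviation "inr \<equiv> amalg_inr C f G k H"

lemma rel_words: "(u, v) \<in> E \<Longrightarrow> u \<in> W \<and> v \<in> W"
  by (induction rule: amalg_rel.induct) auto

lemma equiv_rel: "equiv W E"
proof (rule equivI)
  show "E \<subseteq> W \<times> W"
    using rel_words by (auto simp del: in_lists_conv_set)
  show "refl_on W E"
    by (rule refl_onI) (rule amalg_rel.word_refl)
  show "sym E"
    by (rule symI) (rule amalg_rel.word_sym)
  show "trans E"
    by (rule transI) (rule amalg_rel.word_trans)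
qed

lemma class_eq_iff: "u \<in> W \<Longrightarrow> v \<in> W \<Longrightarrow> E `` {u} = E `` {v} \<longleftrightarrow> (u, v) \<in> E"
  using eq_equiv_class_iff[OF equiv_rel] by blast

lemma carrier_amalg: "carrier X = (\<lambda>w. E `` {w}) ` W"
  by (auto simp: amalg_def quotient_def)

lemma class_closed: "w \<in> W \<Longrightarrow> E `` {w} \<in> carrier X"
  unfolding carrier_amalg by (rule imageI)

lemma carrier_amalgE:
  assumes "x \<in> carrier X"
  obtains w where "w \<in> W" "x = E `` {w}"
  using assms unfolding carrier_amalg by (elim imageE)

lemma one_amalg: "\<one>\<^bsub>X\<^esub> = E `` {[]}"
  by (simp add: amalg_def)

lemma mult_class:
  assumes "u \<in> W" "v \<in> W"
  shows "E `` {u} \<otimes>\<^bsub>X\<^esub> E `` {v} = E `` {u @ v}"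
proof -
  have *: "E `` {u' @ v'} = E `` {u @ v}" if "u' \<in> E `` {u}" "v' \<in> E `` {v}" for u' v'
    using that equiv_class_eq[OF equiv_rel] by (metis Image_singleton_iff amalg_rel.word_append)
  have ne: "E `` {u} \<noteq> {}" "E `` {v} \<noteq> {}"
    using equiv_class_self[OF equiv_rel] assms by blast+
  have "(\<Union>u'\<in>E `` {u}. \<Union>v'\<in>E `` {v}. E `` {u' @ v'}) =
        (\<Union>u'\<in>E `` {u}. \<Union>v'\<in>E `` {v}. E `` {u @ v})"
    by (rule SUP_cong[OF refl], rule SUP_cong[OF refl], rule *)
  also have "\<dots> = E `` {u @ v}"
    using ne by (simp only: UN_constant if_False)
  finally show ?thesis
    by (simp only: amalg_def monoid.simps)
qed

fun inv_letter :: "'a + 'b \<Rightarrow> 'a + 'b" where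
  "inv_letter (Inl a) = Inl (inv\<^bsub>G\<^esub> a)"
| "inv_letter (Inr b) = Inr (inv\<^bsub>H\<^esub> b)"

lemma inv_letter_cancel:
  assumes "s \<in> carrier G <+> carrier H"
  shows "([inv_letter s, s], []) \<in> E"
proof (cases s)
  case (Inl a)
  then have "a \<in> carrier G" using assms by auto
  then show ?thesis
    using Inl amalg_rel.word_trans[OF amalg_rel.mult_left[of "inv\<^bsub>G\<^esub> a" G a C f k H] ] amalg_rel.one_left[of G C f k H]
    by simp
next
  case (Inr b)
  then have "b \<in> carrier H" using assms by auto
  then show ?thesis
    using Inr amalg_rel.word_trans[OF amalg_rel.mult_right[of "inv\<^bsub>H\<^esub> b" H b C f G k] ] amalg_rel.one_right[of H C f G k]
    by simp
qed

lemma inv_letter_closed: "s \<in> carrier G <+> carrier H \<Longrightarrow> inv_letter s \<in> carrier G <+> carrier H"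
  by auto

lemma left_inverse_word: "w \<in> W \<Longrightarrow> \<exists>v\<in>W. (v @ w, []) \<in> E"
proof (induction w)
  case Nil
  then show ?case by (auto intro!: bexI[of _ "[]"] amalg_rel.word_refl)
next
  case (Cons s w)
  then obtain v where v: "v \<in> W" "(v @ w, []) \<in> E" by auto
  have s: "s \<in> carrier G <+> carrier H" and w: "w \<in> W" using Cons.prems by auto
  have "(v @ ([inv_letter s, s] @ w), v @ ([] @ w)) \<in> E"
    using inv_letter_cancel[OF s] v w by (intro amalg_rel.word_append amalg_rel.word_refl)
  then have "((v @ [inv_letter s]) @ (s # w), []) \<in> E"
    using amalg_rel.word_trans[OF _ v(2)] by simp
  moreover have "v @ [inv_letter s] \<in> W"
    using v(1) inv_letter_closed[OF s] by simp
  ultimately show ?case by blast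
qed

lemma group_amalg: "group X"
proof (rule groupI)
  show "x \<otimes>\<^bsub>X\<^esub> y \<in> carrier X" if "x \<in> carrier X" "y \<in> carrier X" for x y
  proof -
    obtain u where u: "u \<in> W" "x = E `` {u}" using \<open>x \<in> carrier X\<close> by (rule carrier_amalgE)
    obtain v where v: "v \<in> W" "y = E `` {v}" using \<open>y \<in> carrier X\<close> by (rule carrier_amalgE)
    have "u @ v \<in> W" using u v by simp
    then show ?thesis
      using u v by (simp only: mult_class class_closed)
  qed
  show "\<one>\<^bsub>X\<^esub> \<in> carrier X"
    unfolding one_amalg by (intro class_closed lists.Nil)
  show "x \<otimes>\<^bsub>X\<^esub> y \<otimes>\<^bsub>X\<^esub> z = x \<otimes>\<^bsub>X\<^esub> (y \<otimes>\<^bsub>X\<^esub> z)"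
    if "x \<in> carrier X" "y \<in> carrier X" "z \<in> carrier X" for x y z
  proof -
    obtain u where u: "u \<in> W" "x = E `` {u}" using \<open>x \<in> carrier X\<close> by (rule carrier_amalgE)
    obtain v where v: "v \<in> W" "y = E `` {v}" using \<open>y \<in> carrier X\<close> by (rule carrier_amalgE)
    obtain w where w: "w \<in> W" "z = E `` {w}" using \<open>z \<in> carrier X\<close> by (rule carrier_amalgE)
    have "u @ v \<in> W" "v @ w \<in> W" using u v w by simp_all
    then show ?thesis
      using u v w by (simp only: mult_class append_assoc)
  qed
  show "\<one>\<^bsub>X\<^esub> \<otimes>\<^bsub>X\<^esub> x = x" if "x \<in> carrier X" for x
    using that unfolding one_amalg
    by (elim carrier_amalgE) (simp only: mult_class lists.Nil append_Nil)
  show "\<exists>y\<in>carrier X. y \<otimes>\<^bsub>X\<^esub> x = \<one>\<^bsub>X\<^esub>" if "x \<in> carrier X" for x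
  proof -
    obtain w where w: "w \<in> W" "x = E `` {w}"
      using \<open>x \<in> carrier X\<close> by (rule carrier_amalgE)
    obtain v where v: "v \<in> W" "(v @ w, []) \<in> E"
      using left_inverse_word[OF w(1)] by blast
    have "E `` {v} \<otimes>\<^bsub>X\<^esub> x = \<one>\<^bsub>X\<^esub>"
      unfolding w(2) one_amalg mult_class[OF v(1) w(1)] by (rule equiv_class_eq[OF equiv_rel v(2)])
    then show ?thesis
      using class_closed[OF v(1)] by blast
  qed
qed

lemma inl_hom: "inl \<in> hom G X"
proof (rule homI)
  show "inl a \<in> carrier X" if "a \<in> carrier G" for a
    unfolding amalg_inl_def using that by (intro class_closed) (simp add: InlI InrI)
  show "inl (a \<otimes>\<^bsub>G\<^esub> b) = inl a \<otimes>\<^bsub>X\<^esub> inl b" if "a \<in> carrier G" "b \<in> carrier G" for a b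
    using that mult_class[of "[Inl a]" "[Inl b]"]
      equiv_class_eq[OF equiv_rel amalg_rel.mult_left[of a G b C f k H]]
    unfolding amalg_inl_def by (simp add: InlI)
qed

lemma inr_hom: "inr \<in> hom H X"
proof (rule homI)
  show "inr b \<in> carrier X" if "b \<in> carrier H" for b
    unfolding amalg_inr_def using that by (intro class_closed) (simp add: InlI InrI)
  show "inr (a \<otimes>\<^bsub>H\<^esub> b) = inr a \<otimes>\<^bsub>X\<^esub> inr b" if "a \<in> carrier H" "b \<in> carrier H" for a b
    using that mult_class[of "[Inr a]" "[Inr b]"]
      equiv_class_eq[OF equiv_rel amalg_rel.mult_right[of a H b C f G k]]
    unfolding amalg_inr_def by (simp add: InrI)
qed

lemma inl_inr_glue: "c \<in> carrier C \<Longrightarrow> inl (f c) = inr (k c)"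
  using equiv_class_eq[OF equiv_rel amalg_rel.glue[of c C f k G H]]
  by (simp add: amalg_inl_def amalg_inr_def)

theorem amalg_universal:
  assumes K: "group K" and p: "p \<in> hom G K" and q: "q \<in> hom H K"
    and pq: "\<And>c. c \<in> carrier C \<Longrightarrow> p (f c) = q (k c)"
  shows "\<exists>u. u \<in> hom X K \<and> (\<forall>a\<in>carrier G. u (inl a) = p a) \<and> (\<forall>b\<in>carrier H. u (inr b) = q b)"
    and "\<And>u v. \<lbrakk>u \<in> hom X K; \<forall>a\<in>carrier G. u (inl a) = p a; \<forall>b\<in>carrier H. u (inr b) = q b;
            v \<in> hom X K; \<forall>a\<in>carrier G. v (inl a) = p a; \<forall>b\<in>carrier H. v (inr b) = q b\<rbrakk>
          \<Longrightarrow> \<forall>x\<in>carrier X. u x = v x"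
proof -
  interpret K: group K by fact
  interpret p: group_hom G K p using p by unfold_locales
  interpret q: group_hom H K q using q by unfold_locales
  define val where "val w = foldr (\<lambda>s y. case_sum p q s \<otimes>\<^bsub>K\<^esub> y) w \<one>\<^bsub>K\<^esub>" for w
  have val_Nil: "val [] = \<one>\<^bsub>K\<^esub>" and val_Cons: "val (s # w) = case_sum p q s \<otimes>\<^bsub>K\<^esub> val w" for s w
    by (simp_all add: val_def)
  have letter: "case_sum p q s \<in> carrier K" if "s \<in> carrier G <+> carrier H" for s
    using that by auto
  have val_closed: "w \<in> W \<Longrightarrow> val w \<in> carrier K" for w
    by (induction w) (auto simp: val_Nil val_Cons)
  have val_append: "u \<in> W \<Longrightarrow> v \<in> W \<Longrightarrow> val (u @ v) = val u \<otimes>\<^bsub>K\<^esub> val v" for u v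
  proof (induction u)
    case Nil
    then show ?case by (simp add: val_Nil val_closed)
  next
    case (Cons s u)
    then show ?case
      using letter[of s] val_closed[of u] val_closed[of v] by (simp add: val_Cons K.m_assoc)
  qed
  have val_eq: "(u, v) \<in> E \<Longrightarrow> val u = val v" for u v
  proof (induction rule: amalg_rel.induct)
    case (word_append u u' v v')
    then show ?case using rel_words val_append by metis
  qed (auto simp: val_Nil val_Cons pq f.hom_closed k.hom_closed)
  define u where "u A = val (SOME w. w \<in> A)" for A
  have u_class: "u (E `` {w}) = val w" if "w \<in> W" for w
  proof -
    have "w \<in> E `` {w}" using that by (auto intro: amalg_rel.word_refl)
    then have "(SOME w'. w' \<in> E `` {w}) \<in> E `` {w}" by (rule someI)
    then show ?thesis unfolding u_def using val_eq by force
  qed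
  have "u \<in> hom X K"
  proof (rule homI)
    show "u x \<in> carrier K" if "x \<in> carrier X" for x
      using that by (elim carrier_amalgE) (simp only: u_class val_closed)
    show "u (x \<otimes>\<^bsub>X\<^esub> y) = u x \<otimes>\<^bsub>K\<^esub> u y" if "x \<in> carrier X" "y \<in> carrier X" for x y
    proof -
      obtain v where v: "v \<in> W" "x = E `` {v}" using \<open>x \<in> carrier X\<close> by (rule carrier_amalgE)
      obtain w where w: "w \<in> W" "y = E `` {w}" using \<open>y \<in> carrier X\<close> by (rule carrier_amalgE)
      have "v @ w \<in> W" using v w by simp
      then show ?thesis
        using v w by (simp only: mult_class u_class val_append)
    qed
  qed
  moreover have "\<forall>a\<in>carrier G. u (inl a) = p a" "\<forall>b\<in>carrier H. u (inr b) = q b"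
    by (auto simp: amalg_inl_def amalg_inr_def u_class val_Cons val_Nil InlI InrI)
  ultimately show "\<exists>u. u \<in> hom X K \<and> (\<forall>a\<in>carrier G. u (inl a) = p a) \<and> (\<forall>b\<in>carrier H. u (inr b) = q b)"
    by blast
  show "\<forall>x\<in>carrier X. u x = v x"
    if u: "u \<in> hom X K" "\<forall>a\<in>carrier G. u (inl a) = p a" "\<forall>b\<in>carrier H. u (inr b) = q b"
      and v: "v \<in> hom X K" "\<forall>a\<in>carrier G. v (inl a) = p a" "\<forall>b\<in>carrier H. v (inr b) = q b" for u v
  proof -
    interpret X: group X by (rule group_amalg)
    interpret u: group_hom X K u using u(1) by unfold_locales
    interpret v: group_hom X K v using v(1) by unfold_locales
    have "u (E `` {w}) = v (E `` {w})" if "w \<in> W" for w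
      using that
    proof (induction w rule: lists.induct)
      case Nil
      then show ?case using u.hom_one v.hom_one by (simp add: one_amalg)
    next
      case (Cons s w)
      have sw: "[s] \<in> W" "w \<in> W" using Cons.hyps by simp_all
      then have cl: "E `` {[s]} \<in> carrier X" "E `` {w} \<in> carrier X"
        by (blast intro: class_closed)+
      have "u (E `` {[s]}) = v (E `` {[s]})"
        using sw(1) u(2,3) v(2,3) by (cases s) (auto simp: amalg_inl_def amalg_inr_def)
      moreover have "E `` {s # w} = E `` {[s]} \<otimes>\<^bsub>X\<^esub> E `` {w}"
        using mult_class[OF sw] by simp
      ultimately show ?case
        using Cons.IH cl by simp
    qed
    then show ?thesis unfolding carrier_amalg by (intro ballI) (elim imageE, simp only:)
  qed
qed

end

text \<open>\<open>G *\<^sub>\<int> H\<close> with \<open>\<int>\<close> mapped to the two factors by \<open>1 \<mapsto> zG\<close> and \<open>1 \<mapsto> zH\<close>.\<close>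

definition cyclic_amalg ::
  "('a, 'y) monoid_scheme \<Rightarrow> 'a \<Rightarrow> ('b, 'w) monoid_scheme \<Rightarrow> 'b \<Rightarrow> (('a + 'b) list set) monoid" where
  "cyclic_amalg G zG H zH =
     amalg integer_group (\<lambda>n. zG [^]\<^bsub>G\<^esub> n) G (\<lambda>n. zH [^]\<^bsub>H\<^esub> n) H"

definition cyclic_amalg_inl ::
  "('a, 'y) monoid_scheme \<Rightarrow> 'a \<Rightarrow> ('b, 'w) monoid_scheme \<Rightarrow> 'b \<Rightarrow> 'a \<Rightarrow> ('a + 'b) list set" where
  "cyclic_amalg_inl G zG H zH =
     amalg_inl integer_group (\<lambda>n. zG [^]\<^bsub>G\<^esub> n) G (\<lambda>n. zH [^]\<^bsub>H\<^esub> n) H"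

definition cyclic_amalg_inr ::
  "('a, 'y) monoid_scheme \<Rightarrow> 'a \<Rightarrow> ('b, 'w) monoid_scheme \<Rightarrow> 'b \<Rightarrow> 'b \<Rightarrow> ('a + 'b) list set" where
  "cyclic_amalg_inr G zG H zH =
     amalg_inr integer_group (\<lambda>n. zG [^]\<^bsub>G\<^esub> n) G (\<lambda>n. zH [^]\<^bsub>H\<^esub> n) H"

lemma cyclic_amalgam_data:
  assumes "group G" "zG \<in> carrier G" "group H" "zH \<in> carrier H"
  shows "amalgam_data integer_group (\<lambda>n. zG [^]\<^bsub>G\<^esub> n) G (\<lambda>n. zH [^]\<^bsub>H\<^esub> n) H"
proof -
  interpret G: group G by fact
  interpret H: group H by fact
  show ?thesis
    by (intro amalgam_data.intro group_hom.intro group_hom_axioms.intro group_integer_group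
        G.hom_integer_group_pow H.hom_integer_group_pow assms)
qed

text \<open>The elements \<open>x\<^sub>i = g\<^sub>i zH\<inverse> h\<^sub>1\<close> of \<open>G *\<^sub>\<int> H\<close>, for enumerated generating sets
  \<open>gs = [g\<^sub>1, \<dots>, g\<^sub>m]\<close> and \<open>hs = [h\<^sub>1, \<dots>, h\<^sub>n]\<close>.\<close>

definition twisted_gens ::
  "('a, 'y) monoid_scheme \<Rightarrow> 'a \<Rightarrow> ('b, 'w) monoid_scheme \<Rightarrow> 'b \<Rightarrow> 'a list \<Rightarrow> 'b list
   \<Rightarrow> ('a + 'b) list set list" where
  "twisted_gens G zG H zH gs hs =
     map (\<lambda>g. cyclic_amalg_inl G zG H zH g
            \<otimes>\<^bsub>cyclic_amalg G zG H zH\<^esub>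
              inv\<^bsub>cyclic_amalg G zG H zH\<^esub> (cyclic_amalg_inr G zG H zH zH)
            \<otimes>\<^bsub>cyclic_amalg G zG H zH\<^esub> cyclic_amalg_inr G zG H zH (hd hs)) gs"

end

theory Submission
  imports Defs
begin

text \<open>Write \<open>z\<close> for \<open>zG = zH\<close>. Since \<open>z\<close> is cofinal in both factors, the interval \<open>[1, z)\<close> is a transversal of
  the cosets of \<open>\<langle>z\<rangle>\<close> in \<open>G\<close>, and \<open>(z\<inverse>, 1]\<close> one in \<open>H\<close>. So every element of \<open>X\<close> has a unique normal form
  \<open>h a\<^sub>1 b\<^sub>1 \<dots> a\<^sub>n b\<^sub>n\<close> with \<open>1 < a\<^sub>i < z\<close> and \<open>z\<inverse> < b\<^sub>i \<le> 1\<close>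
  (\<open>b\<^sub>i \<noteq> 1\<close> for \<open>i < n\<close>), and the sign of an element is that of \<open>h\<close>
  (an element with \<open>h = 1\<close> is positive or trivial). If \<open>h \<ge> 1\<close>, writing \<open>b\<^sub>i = z\<inverse> p\<^sub>i\<close> with \<open>p\<^sub>i \<ge> h\<^sub>1\<close>
  exhibits the element as a product of elements \<open>x\<^sub>g = g z\<inverse> h\<^sub>1\<close> and positive elements of \<open>H\<close>. If
  \<open>h < 1\<close>, the inverse equals
  \<open>b\<^sub>n\<inverse> (z a\<^sub>n\<inverse>) (z\<inverse> b\<^sub>n\<^sub>-\<^sub>1\<inverse>) (z a\<^sub>n\<^sub>-\<^sub>1\<inverse>) \<dots> (z a\<^sub>1\<inverse>) (z\<inverse> h\<inverse>)\<close>, which is such a product as well.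
  Conversely, \<open>X\<close> acts on the normal forms, and the elements \<open>x\<^sub>g\<close> and the positive elements of \<open>H\<close> map
  forms with \<open>h \<ge> 1\<close> to non-trivial forms with \<open>h \<ge> 1\<close>; so no product of them is trivial.\<close>

section \<open>Left ordered groups\<close>

locale left_ordered_group = group G for G (structure) +
  fixes R :: "'a rel"
  assumes ordering: "left_ordering G R"
begin

abbreviation less (infix "\<triangleleft>" 50) where "a \<triangleleft> b \<equiv> (a, b) \<in> R"
abbreviation "P \<equiv> positive_cone G R"

lemma less_closed: "a \<triangleleft> b \<Longrightarrow> a \<in> carrier G \<and> b \<in> carrier G"
  using ordering by (auto simp: left_ordering_def)

lemma less_trans [trans]: "a \<triangleleft> b \<Longrightarrow> b \<triangleleft> c \<Longrightarrow> a \<triangleleft> c"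
  using ordering less_closed
  by (auto simp: left_ordering_def strict_linear_order_on_def elim: transE)

lemma less_irrefl: "\<not> a \<triangleleft> a"
  using ordering by (auto simp: left_ordering_def strict_linear_order_on_def irrefl_def)

lemma less_linear: "a \<in> carrier G \<Longrightarrow> b \<in> carrier G \<Longrightarrow> a \<triangleleft> b \<or> a = b \<or> b \<triangleleft> a"
  using ordering by (auto simp: left_ordering_def strict_linear_order_on_def total_on_def)

lemma less_mult_left: "h \<in> carrier G \<Longrightarrow> a \<triangleleft> b \<Longrightarrow> h \<otimes> a \<triangleleft> h \<otimes> b"
  using ordering by (auto simp: left_ordering_def)

lemma less_mult_left_iff:
  assumes "h \<in> carrier G" "a \<in> carrier G" "b \<in> carrier G"
  shows "h \<otimes> a \<triangleleft> h \<otimes> b \<longleftrightarrow> a \<triangleleft> b"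
  using assms less_mult_left[of h a b] less_mult_left[of "inv h" "h \<otimes> a" "h \<otimes> b"]
  by (auto simp: m_assoc[symmetric])

lemma less_iff_cone: "a \<in> carrier G \<Longrightarrow> b \<in> carrier G \<Longrightarrow> a \<triangleleft> b \<longleftrightarrow> inv a \<otimes> b \<in> P"
  using left_ordering_iff_positive[OF is_group ordering] .

lemma cone_iff: "p \<in> P \<longleftrightarrow> \<one> \<triangleleft> p"
  using less_closed by (auto simp: positive_cone_def)

lemma cone_closed: "p \<in> P \<Longrightarrow> p \<in> carrier G"
  by (simp add: positive_cone_def)

lemma one_notin_cone: "\<one> \<notin> P"
  by (simp add: cone_iff less_irrefl)

lemma less_mult_cone: "a \<in> carrier G \<Longrightarrow> p \<in> P \<Longrightarrow> a \<triangleleft> a \<otimes> p"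
  using less_mult_left[of a \<one> p] by (simp add: cone_iff)

lemma cone_mult: "p \<in> P \<Longrightarrow> q \<in> P \<Longrightarrow> p \<otimes> q \<in> P"
  using less_mult_cone[of p q] less_trans by (auto simp: cone_iff cone_closed)

lemma cone_cases:
  assumes "a \<in> carrier G"
  shows "a \<in> P \<or> a = \<one> \<or> inv a \<in> P"
  using less_linear[of \<one> a] less_iff_cone[of a \<one>] assms by (auto simp: cone_iff)

lemma less_one_iff: "a \<in> carrier G \<Longrightarrow> a \<triangleleft> \<one> \<longleftrightarrow> inv a \<in> P"
  using less_iff_cone[of a \<one>] by simp

text \<open>Only the left factor of a product matters: a < ab whenever b is positive, so a lower
  bound on the generators passes to all products.\<close>

lemma semigroup_cone_least:
  assumes S: "P = semigroup_generated G S" and s: "s \<in> S" "\<And>t. t \<in> S \<Longrightarrow> t = s \<or> s \<triangleleft> t"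
    and p: "p \<in> P"
  shows "p = s \<or> s \<triangleleft> p"
proof -
  have "p \<in> semigroup_generated G S" using p S by simp
  then show ?thesis
  proof induction
    case (gen_mult a b)
    then have "a \<in> P" "b \<in> P" using S by auto
    then have "a \<triangleleft> a \<otimes> b" by (simp add: less_mult_cone cone_closed)
    then show ?case using gen_mult.IH(1) less_trans by blast
  qed (use s in auto)
qed

section \<open>Right invariance and cofinality\<close>

lemma right_mult_less_iff:
  assumes "right_invariant G R z" "z \<in> carrier G" "a \<in> carrier G" "b \<in> carrier G"
  shows "a \<otimes> z \<triangleleft> b \<otimes> z \<longleftrightarrow> a \<triangleleft> b"
proof -
  have "a \<otimes> z \<triangleleft> b \<otimes> z" if "a \<triangleleft> b" for a b
    using assms(1) that by (auto simp: right_invariant_def)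
  from this[of a b] this[of b a] show ?thesis
    using less_linear[of a b] assms less_trans less_irrefl by blast
qed

lemma right_mult_pow_less_iff:
  fixes n :: nat
  assumes "right_invariant G R z" "z \<in> carrier G" "a \<in> carrier G" "b \<in> carrier G"
  shows "a \<otimes> z [^] n \<triangleleft> b \<otimes> z [^] n \<longleftrightarrow> a \<triangleleft> b"
proof (induction n)
  case (Suc n)
  have "c \<otimes> z [^] Suc n = (c \<otimes> z [^] n) \<otimes> z" if "c \<in> carrier G" for c
    using that assms(2) by (simp add: m_assoc)
  then show ?case using Suc assms right_mult_less_iff by simp
qed (use assms in simp)

text \<open>Bounds multiply: a < z^m and b < z^n give ab < a z^n < z^m z^n, where the second
  comparison is right invariance. Hence every positive element lies below a power of
  \<open>z\<close>.\<close>

lemma cofinal_of_generators: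
  assumes inv: "right_invariant G R z" and S: "P = semigroup_generated G S"
    and less: "\<And>s. s \<in> S \<Longrightarrow> s \<triangleleft> z" and z: "z \<in> P"
  shows "cofinal_elt G R z"
  unfolding cofinal_elt_def
proof
  have zc: "z \<in> carrier G" using z by (rule cone_closed)
  have bound: "\<exists>n::nat. p \<triangleleft> z [^] n" if "p \<in> P" for p
  proof -
    have "p \<in> semigroup_generated G S" using that S by simp
    then show ?thesis
    proof induction
      case (gen_incl s)
      then have "s \<triangleleft> z [^] (1::nat)" using less zc by simp
      then show ?case ..
    next
      case (gen_mult a b)
      then obtain m n :: nat where mn: "a \<triangleleft> z [^] m" "b \<triangleleft> z [^] n" by auto
      have c: "a \<in> carrier G" "b \<in> carrier G" using mn less_closed by auto
      have "a \<otimes> b \<triangleleft> a \<otimes> z [^] n" using c mn less_mult_left by simp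
      also have "a \<otimes> z [^] n \<triangleleft> z [^] m \<otimes> z [^] n"
        using right_mult_pow_less_iff[OF inv zc c(1)] mn zc by simp
      finally show ?case using zc by (auto simp: nat_pow_mult)
    qed
  qed
  fix g assume g: "g \<in> carrier G"
  consider "g \<in> P" | "g = \<one>" | "inv g \<in> P" using cone_cases[OF g] by blast
  then show "\<exists>(k::int) (K::int). z [^] k \<triangleleft> g \<and> g \<triangleleft> z [^] K"
  proof cases
    case 1
    then obtain n :: nat where "g \<triangleleft> z [^] n" using bound by blast
    then have "g \<triangleleft> z [^] int n" by (simp add: int_pow_int)
    moreover have "z [^] (0::int) \<triangleleft> g" using 1 by (simp add: cone_iff)
    ultimately show ?thesis by blast
  next
    case 2
    have "z [^] (-1::int) \<triangleleft> \<one>" "\<one> \<triangleleft> z [^] (1::int)"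
      using z zc less_one_iff[of "inv z"] by (simp_all add: cone_iff int_pow_neg)
    then show ?thesis using 2 by blast
  next
    case 3
    then obtain n :: nat where n: "inv g \<triangleleft> z [^] n" using bound by blast
    \<comment> \<open>The lower bound for a negative g comes from cancelling z^n on the right of 1 <
      g z^n.\<close>
    have "\<one> \<triangleleft> g \<otimes> z [^] n" using less_mult_left[OF g n] g by simp
    then have "z [^] (- int n) \<otimes> z [^] n \<triangleleft> g \<otimes> z [^] n"
      using zc by (simp add: int_pow_neg int_pow_int)
    then have "z [^] (- int n) \<triangleleft> g"
      using right_mult_pow_less_iff[OF inv zc _ g] zc by simp
    moreover have "g \<triangleleft> z [^] (0::int)" using 3 g less_one_iff by simp
    ultimately show ?thesis by blast
  qed
qed

section \<open>Powers of a cofinal element and transversals of its cosets\<close>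

lemma int_pow_cone:
  fixes n :: int
  assumes "z \<in> P" "0 < n"
  shows "z [^] n \<in> P"
proof -
  have "z [^] Suc m \<in> P" for m :: nat
    by (induction m) (use assms cone_mult cone_closed in auto)
  moreover have "n = int (Suc (nat (n - 1)))" using assms by simp
  ultimately show ?thesis by (metis int_pow_int)
qed

lemma int_pow_less_iff:
  fixes m n :: int
  assumes "z \<in> P"
  shows "z [^] m \<triangleleft> z [^] n \<longleftrightarrow> m < n"
proof -
  have zc: "z \<in> carrier G" using assms by (rule cone_closed)
  have *: "z [^] m \<triangleleft> z [^] n" if "m < n" for m n :: int
    using less_mult_cone[of "z [^] m" "z [^] (n - m)"] int_pow_cone[of z "n - m"] that assms zc
      int_pow_mult[OF zc, of m "n - m"] by simp
  then show ?thesis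
    using *[of m n] *[of n m] less_irrefl less_trans by (metis linorder_cases)
qed

text \<open>A discrete intermediate value argument: the power z^k lies below \<open>g\<close>, and
  if no step from n to n + 1 crossed \<open>g\<close>, upward induction would keep all later powers
  at or below \<open>g\<close>, against g < z^K.\<close>

lemma cofinal_floor:
  assumes "z \<in> P" "cofinal_elt G R z" "g \<in> carrier G"
  obtains n :: int where "z [^] n = g \<or> z [^] n \<triangleleft> g" "g \<triangleleft> z [^] (n + 1)"
proof -
  obtain k K :: int where kK: "z [^] k \<triangleleft> g" "g \<triangleleft> z [^] K"
    using assms by (auto simp: cofinal_elt_def)
  have zc: "z \<in> carrier G" using assms(1) by (rule cone_closed)
  have "k < K" using kK less_trans int_pow_less_iff[OF assms(1)] by blast
  have "\<exists>n::int. (z [^] n = g \<or> z [^] n \<triangleleft> g) \<and> g \<triangleleft> z [^] (n + 1)"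
  proof (rule ccontr)
    assume no: "\<nexists>n::int. (z [^] n = g \<or> z [^] n \<triangleleft> g) \<and> g \<triangleleft> z [^] (n + 1)"
    have "z [^] n = g \<or> z [^] n \<triangleleft> g" if "k \<le> n" for n
      using that
    proof (induction n rule: int_ge_induct)
      case (step n)
      then have "\<not> g \<triangleleft> z [^] (n + 1)" using no by blast
      then show ?case using less_linear[of g "z [^] (n + 1)"] assms(3) zc by auto
    qed (use kK in simp)
    then show False using kK(2) \<open>k < K\<close> less_trans less_irrefl by (metis less_imp_le)
  qed
  then show thesis using that by blast
qed

text \<open>With n the floor of g, the element a = z^-n g lies in [1, z) by left invariance.
  Uniqueness holds because m < n forces z^m a < z^(m+1) <= z^n <= z^n b.\<close>

lemma bij_betw_floor:
  assumes z: "z \<in> P" and cof: "cofinal_elt G R z"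
  shows "bij_betw (\<lambda>(n::int, a). z [^] n \<otimes> a)
    (UNIV \<times> {a. a = \<one> \<or> \<one> \<triangleleft> a \<and> a \<triangleleft> z}) (carrier G)" (is "bij_betw _ (UNIV \<times> ?A) _")
proof -
  have zc: "z \<in> carrier G" using z by (rule cone_closed)
  have cl: "a \<in> carrier G" if "a \<in> ?A" for a using that less_closed by auto
  have not_less: "\<not> m < n" if eq: "z [^] m \<otimes> a = z [^] n \<otimes> b" and ab: "a \<in> ?A" "b \<in> ?A"
    for m n :: int and a b
  proof
    assume "m < n"
    have "a \<triangleleft> z" using ab z by (auto simp: cone_iff)
    then have "z [^] m \<otimes> a \<triangleleft> z [^] (m + 1)"
      using less_mult_left[of "z [^] m" a z] zc by (simp add: int_pow_mult)
    also have "z [^] (m + 1) \<triangleleft> z [^] (n + 1)" using int_pow_less_iff[OF z] \<open>m < n\<close> by simp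
    finally have "z [^] m \<otimes> a \<triangleleft> z [^] (n + 1)" .
    have "z [^] m \<otimes> a \<triangleleft> z [^] n \<otimes> b"
    proof -
      have 1: "z [^] m \<otimes> a \<triangleleft> z [^] (m + 1)" by fact
      have 2: "z [^] (m + 1) = z [^] n \<or> z [^] (m + 1) \<triangleleft> z [^] n"
        using int_pow_less_iff[OF z] \<open>m < n\<close> by (cases "m + 1 = n") auto
      have 3: "z [^] n = z [^] n \<otimes> b \<or> z [^] n \<triangleleft> z [^] n \<otimes> b"
        using ab(2) less_mult_cone[of "z [^] n" b] zc by (auto simp: cone_iff)
      show ?thesis using 1 2 3 less_trans by metis
    qed
    then show False using eq less_irrefl by simp
  qed
  have inj: "inj_on (\<lambda>(n::int, a). z [^] n \<otimes> a) (UNIV \<times> ?A)"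
  proof (rule inj_onI, clarify)
    fix m n :: int and a b
    assume ab: "a = \<one> \<or> \<one> \<triangleleft> a \<and> a \<triangleleft> z" "b = \<one> \<or> \<one> \<triangleleft> b \<and> b \<triangleleft> z"
      and eq: "z [^] m \<otimes> a = z [^] n \<otimes> b"
    have "\<not> m < n" by (rule not_less[OF eq]) (use ab in simp_all)
    moreover have "\<not> n < m" by (rule not_less[OF eq[symmetric]]) (use ab in simp_all)
    ultimately have "m = n" by simp
    then show "m = n \<and> a = b" using eq ab cl[of a] cl[of b] zc by simp
  qed
  have "\<exists>n::int. \<exists>a\<in>?A. g = z [^] n \<otimes> a" if g: "g \<in> carrier G" for g
  proof -
    obtain n :: int where n: "z [^] n = g \<or> z [^] n \<triangleleft> g" "g \<triangleleft> z [^] (n + 1)"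
      using cofinal_floor[OF z cof g] .
    define a where "a = inv (z [^] n) \<otimes> g"
    have ga: "g = z [^] n \<otimes> a" using g zc by (simp add: a_def m_assoc[symmetric])
    have ac: "a \<in> carrier G" using g zc by (simp add: a_def)
    have "a \<triangleleft> z"
      using n(2) less_mult_left_iff[of "z [^] n" a z] ga[symmetric] ac zc by (simp add: int_pow_mult)
    moreover have "a = \<one> \<or> \<one> \<triangleleft> a"
      using n(1)
    proof
      assume "z [^] n = g"
      then show ?thesis using g by (simp add: a_def)
    next
      assume "z [^] n \<triangleleft> g"
      then show ?thesis using less_mult_left[of "inv (z [^] n)" "z [^] n" g] zc by (simp add: a_def)
    qed
    ultimately have "a \<in> ?A" by auto
    then show ?thesis using ga by blast
  qed
  then have "carrier G \<subseteq> (\<lambda>(n::int, a). z [^] n \<otimes> a) ` (UNIV \<times> ?A)" by fast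
  moreover have "(\<lambda>(n::int, a). z [^] n \<otimes> a) ` (UNIV \<times> ?A) \<subseteq> carrier G"
  proof clarify
    fix n :: int and a assume "a = \<one> \<or> \<one> \<triangleleft> a \<and> a \<triangleleft> z"
    then show "z [^] n \<otimes> a \<in> carrier G" using cl[of a] zc by simp
  qed
  ultimately show ?thesis
    by (intro bij_betw_imageI inj equalityI)
qed

text \<open>A reindexing of \<open>bij_betw_floor\<close>: a nontrivial b in (z^-1, 1) corresponds
  to zb in (1, z) with the exponent lowered by one, while 1 stays in place.\<close>

lemma bij_betw_ceiling:
  assumes z: "z \<in> P" and cof: "cofinal_elt G R z"
  shows "bij_betw (\<lambda>(n::int, a). z [^] n \<otimes> a)
    (UNIV \<times> {a. a = \<one> \<or> inv z \<triangleleft> a \<and> a \<triangleleft> \<one>}) (carrier G)" (is "bij_betw _ (UNIV \<times> ?B) _")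
proof -
  let ?A = "{a. a = \<one> \<or> \<one> \<triangleleft> a \<and> a \<triangleleft> z}"
  have zc: "z \<in> carrier G" using z by (rule cone_closed)
  define f where "f = (\<lambda>(n::int, a). if a = \<one> then (n, a) else (n + 1, inv z \<otimes> a))"
  define f' where "f' = (\<lambda>(n::int, b). if b = \<one> then (n, b) else (n - 1, z \<otimes> b))"
  have A: "a \<in> carrier G" "a \<noteq> \<one> \<Longrightarrow> inv z \<otimes> a \<in> ?B - {\<one>}" if "a \<in> ?A" for a
  proof -
    show a: "a \<in> carrier G" using that less_closed by auto
    show "inv z \<otimes> a \<in> ?B - {\<one>}" if "a \<noteq> \<one>"
      using \<open>a \<in> ?A\<close> that a zc less_mult_left[of "inv z" \<one> a] less_mult_left[of "inv z" a z]
        less_irrefl by auto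
  qed
  have B: "b \<in> carrier G" "b \<noteq> \<one> \<Longrightarrow> z \<otimes> b \<in> ?A - {\<one>}" if "b \<in> ?B" for b
  proof -
    show b: "b \<in> carrier G" using that less_closed by auto
    show "z \<otimes> b \<in> ?A - {\<one>}" if "b \<noteq> \<one>"
      using \<open>b \<in> ?B\<close> that b zc less_mult_left[of z b \<one>] less_mult_left[of z "inv z" b]
        less_irrefl by auto
  qed
  have bij: "bij_betw f' (UNIV \<times> ?B) (UNIV \<times> ?A)"
  proof (rule bij_betw_byWitness[where f' = f])
    show "\<forall>x\<in>UNIV \<times> ?B. f (f' x) = x"
    proof clarify
      fix n :: int and b assume "b = \<one> \<or> inv z \<triangleleft> b \<and> b \<triangleleft> \<one>"
      then show "f (f' (n, b)) = (n, b)"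
        using B[of b] zc by (cases "b = \<one>") (simp_all add: f_def f'_def m_assoc[symmetric])
    qed
    show "\<forall>x\<in>UNIV \<times> ?A. f' (f x) = x"
    proof clarify
      fix n :: int and a assume "a = \<one> \<or> \<one> \<triangleleft> a \<and> a \<triangleleft> z"
      then show "f' (f (n, a)) = (n, a)"
        using A[of a] zc by (cases "a = \<one>") (simp_all add: f_def f'_def m_assoc[symmetric])
    qed
    show "f' ` (UNIV \<times> ?B) \<subseteq> UNIV \<times> ?A"
    proof (rule image_subsetI)
      fix x :: "int \<times> 'a" assume "x \<in> UNIV \<times> ?B"
      then show "f' x \<in> UNIV \<times> ?A" using B[of "snd x"] by (cases "snd x = \<one>") (auto simp: f'_def)
    qed
    show "f ` (UNIV \<times> ?A) \<subseteq> UNIV \<times> ?B"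
    proof (rule image_subsetI)
      fix x :: "int \<times> 'a" assume "x \<in> UNIV \<times> ?A"
      then show "f x \<in> UNIV \<times> ?B" using A[of "snd x"] by (cases "snd x = \<one>") (auto simp: f_def)
    qed
  qed
  have "bij_betw ((\<lambda>(n::int, a). z [^] n \<otimes> a) \<circ> f') (UNIV \<times> ?B) (carrier G)"
    using bij_betw_trans[OF bij bij_betw_floor[OF assms]] .
  moreover have "((\<lambda>(n::int, a). z [^] n \<otimes> a) \<circ> f') x = (\<lambda>(n::int, a). z [^] n \<otimes> a) x"
    if x: "x \<in> UNIV \<times> ?B" for x
  proof -
    obtain n b where x': "x = (n, b)" "b \<in> ?B" using x by auto
    have "z [^] (n - 1) \<otimes> (z \<otimes> b) = z [^] n \<otimes> b"
      using B(1)[OF x'(2)] zc int_pow_mult[OF zc, of "n - 1" 1] by (simp add: m_assoc[symmetric])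
    then show ?thesis by (simp add: x' f'_def)
  qed
  ultimately show ?thesis by (metis (no_types, lifting) bij_betw_cong)
qed

end

lemma (in group) mult_inv_cancel [simp]:
  assumes "x \<in> carrier G" "y \<in> carrier G"
  shows "x \<otimes> (inv x \<otimes> y) = y" "inv x \<otimes> (x \<otimes> y) = y"
  using assms by (simp_all add: m_assoc[symmetric])

lemma (in left_ordered_group) right_invariant_conj:
  assumes "right_invariant G R z" "z \<in> carrier G" "p \<in> P"
  shows "inv z \<otimes> p \<otimes> z \<in> P" "z \<otimes> p \<otimes> inv z \<in> P"
proof -
  have p: "p \<in> carrier G" "\<one> \<triangleleft> p" using assms(3) by (simp_all add: cone_closed cone_iff)
  have "z \<triangleleft> p \<otimes> z"
    using right_mult_less_iff[OF assms(1,2) one_closed p(1)] p assms(2) by simp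
  then show "inv z \<otimes> p \<otimes> z \<in> P"
    using less_iff_cone[of z "p \<otimes> z"] p assms(2) by (simp add: m_assoc)
  have "\<one> \<otimes> z \<triangleleft> (z \<otimes> p \<otimes> inv z) \<otimes> z"
    using less_mult_left[OF assms(2) p(2)] p assms(2) by (simp add: m_assoc)
  then show "z \<otimes> p \<otimes> inv z \<in> P"
    using right_mult_less_iff[OF assms(1,2) one_closed, of "z \<otimes> p \<otimes> inv z"] p assms(2)
    by (simp add: cone_iff)
qed

text \<open>Conjugation by \<open>z\<close> in either direction preserves the cone, so neither
  conjugate of the least positive element drops below it: z^-1 h z >= h reads zh <= hz, and z h z^-1
  >= h reads hz <= zh.\<close>

lemma (in left_ordered_group) least_commutes:
  assumes inv: "right_invariant G R z" and z: "z \<in> carrier G"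
    and h: "h \<in> P" "\<And>p. p \<in> P \<Longrightarrow> p = h \<or> h \<triangleleft> p"
  shows "z \<otimes> h = h \<otimes> z"
proof -
  have hc: "h \<in> carrier G" using h(1) by (rule cone_closed)
  have "inv z \<otimes> h \<otimes> z = h \<or> h \<triangleleft> inv z \<otimes> h \<otimes> z"
    using right_invariant_conj(1)[OF inv z h(1)] by (rule h(2))
  moreover have "h \<otimes> z = z \<otimes> (inv z \<otimes> h \<otimes> z)" using hc z by (simp add: m_assoc[symmetric])
  ultimately have 1: "h \<otimes> z = z \<otimes> h \<or> z \<otimes> h \<triangleleft> h \<otimes> z"
    using less_mult_left[OF z, of h "inv z \<otimes> h \<otimes> z"] by metis
  have "z \<otimes> h \<otimes> inv z = h \<or> h \<triangleleft> z \<otimes> h \<otimes> inv z"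
    using right_invariant_conj(2)[OF inv z h(1)] by (rule h(2))
  moreover have "z \<otimes> h = z \<otimes> h \<otimes> inv z \<otimes> z" using hc z by (simp add: m_assoc)
  ultimately have 2: "z \<otimes> h = h \<otimes> z \<or> h \<otimes> z \<triangleleft> z \<otimes> h"
    using right_mult_less_iff[OF inv z hc, of "z \<otimes> h \<otimes> inv z"] hc z by auto
  show ?thesis using 1 2 less_trans less_irrefl by metis
qed

section \<open>Orderings determined by cones; isolated orderings\<close>

definition cone_ordering :: "('a, 'c) monoid_scheme \<Rightarrow> 'a set \<Rightarrow> 'a rel" where
  "cone_ordering G P = {(a, b). a \<in> carrier G \<and> b \<in> carrier G \<and> inv\<^bsub>G\<^esub> a \<otimes>\<^bsub>G\<^esub> b \<in> P}"

lemma (in group) cone_ordering: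
  assumes P: "P \<subseteq> carrier G" "\<And>p q. p \<in> P \<Longrightarrow> q \<in> P \<Longrightarrow> p \<otimes> q \<in> P" "\<one> \<notin> P"
    and total: "\<And>a. a \<in> carrier G \<Longrightarrow> a \<in> P \<or> a = \<one> \<or> inv a \<in> P"
  shows "left_ordering G (cone_ordering G P)" "positive_cone G (cone_ordering G P) = P"
proof -
  let ?R = "cone_ordering G P"
  have "trans ?R"
  proof (rule transI)
    fix a b c assume ab: "(a, b) \<in> ?R" and bc: "(b, c) \<in> ?R"
    then have cl: "a \<in> carrier G" "b \<in> carrier G" "c \<in> carrier G"
      by (auto simp: cone_ordering_def)
    have "inv a \<otimes> c = (inv a \<otimes> b) \<otimes> (inv b \<otimes> c)"
      using cl by (simp add: m_assoc)
    then show "(a, c) \<in> ?R"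
      using ab bc cl P(2) by (simp add: cone_ordering_def)
  qed
  moreover have "irrefl ?R"
    using P(3) by (auto simp: irrefl_def cone_ordering_def)
  moreover have "total_on (carrier G) ?R"
  proof (rule total_onI)
    fix a b assume ab: "a \<in> carrier G" "b \<in> carrier G" "a \<noteq> b"
    have "inv a \<otimes> b \<noteq> \<one>"
      using ab inv_equality inv_inv inv_closed by metis
    moreover have "inv (inv a \<otimes> b) = inv b \<otimes> a" using ab by (simp add: inv_mult_group)
    ultimately show "(a, b) \<in> ?R \<or> (b, a) \<in> ?R"
      using total[of "inv a \<otimes> b"] ab by (auto simp: cone_ordering_def)
  qed
  moreover have "(h \<otimes> a, h \<otimes> b) \<in> ?R" if "h \<in> carrier G" "(a, b) \<in> ?R" for h a b
  proof -
    have cl: "a \<in> carrier G" "b \<in> carrier G" using that by (auto simp: cone_ordering_def)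
    have "inv (h \<otimes> a) \<otimes> (h \<otimes> b) = inv a \<otimes> (inv h \<otimes> h \<otimes> b)"
      using cl that(1) by (simp add: inv_mult_group m_assoc del: l_inv)
    then show ?thesis using that cl by (simp add: cone_ordering_def)
  qed
  moreover have "?R \<subseteq> carrier G \<times> carrier G" by (auto simp: cone_ordering_def)
  ultimately show "left_ordering G ?R"
    by (auto simp: left_ordering_def strict_linear_order_on_def)
  show "positive_cone G ?R = P"
    using P(1) by (auto simp: positive_cone_def cone_ordering_def)
qed

lemma semigroup_generated_least:
  assumes "S \<subseteq> T" "\<And>a b. a \<in> T \<Longrightarrow> b \<in> T \<Longrightarrow> a \<otimes>\<^bsub>G\<^esub> b \<in> T"
  shows "semigroup_generated G S \<subseteq> T"
proof
  fix x assume "x \<in> semigroup_generated G S"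
  then show "x \<in> T" by induction (use assms in auto)
qed

lemma semigroup_generated_empty [simp]: "semigroup_generated G {} = {}"
  using semigroup_generated_least[of "{}" "{}" G] by simp

text \<open>The ordering of a finitely generated cone is the only one that makes all generators positive.\<close>

lemma isolated_if_defines_isolated:
  assumes G: "group G" and S: "defines_isolated_ordering G S R"
  shows "isolated_ordering G R"
proof -
  have fin: "finite S" and Sc: "S \<subseteq> carrier G" and lo: "left_ordering G R"
    and P: "positive_cone G R = semigroup_generated G S"
    using S by (auto simp: defines_isolated_ordering_def)
  interpret R: left_ordered_group G R
    using G lo by (simp add: left_ordered_group_def left_ordered_group_axioms_def)
  let ?U = "\<lambda>S. {R. left_ordering G R \<and> (\<forall>s\<in>S. (\<one>\<^bsub>G\<^esub>, s) \<in> R)}"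
  have "openin (LO_topology G) (?U S)"
    using fin Sc
  proof (induction S)
    case empty
    then show ?case
      unfolding LO_topology_def by (intro topology_generated_by_Basis) simp
  next
    case (insert s S)
    have "openin (LO_topology G) {R. left_ordering G R \<and> (\<one>\<^bsub>G\<^esub>, s) \<in> R}"
      unfolding LO_topology_def by (intro topology_generated_by_Basis) (use insert.prems in auto)
    moreover have "?U (insert s S) = {R. left_ordering G R \<and> (\<one>\<^bsub>G\<^esub>, s) \<in> R} \<inter> ?U S" by auto
    ultimately show ?case using insert by auto
  qed
  moreover have "?U S = {R}"
  proof (intro equalityI subsetI)
    fix R' assume R': "R' \<in> ?U S"
    then interpret R': left_ordered_group G R'
      using G by (simp add: left_ordered_group_def left_ordered_group_axioms_def)
    have sub: "R.P \<subseteq> R'.P"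
      unfolding P using R' R'.cone_iff R'.cone_mult by (intro semigroup_generated_least) auto
    \<comment> \<open>A positive cone is maximal: a p outside \<open>R.P\<close> would have its
      inverse in \<open>R.P\<close>, hence in \<open>R'.P\<close>, which would then contain
      1.\<close>
    have "R'.P \<subseteq> R.P"
    proof
      fix p assume p: "p \<in> R'.P"
      show "p \<in> R.P"
      proof (rule ccontr)
        assume "p \<notin> R.P"
        then have "inv\<^bsub>G\<^esub> p \<in> R.P"
          using R.cone_cases[of p] R'.cone_closed[OF p] R'.one_notin_cone p by auto
        then have "inv\<^bsub>G\<^esub> p \<otimes>\<^bsub>G\<^esub> p \<in> R'.P" using R'.cone_mult sub p by blast
        then show False using R'.one_notin_cone R'.cone_closed[OF p] by simp
      qed
    qed
    with sub have "R.P = R'.P" by simp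
    then have "(a, b) \<in> R \<longleftrightarrow> (a, b) \<in> R'" for a b
      using R.less_iff_cone R'.less_iff_cone R.less_closed R'.less_closed by metis
    then show "R' \<in> {R}" by auto
  next
    fix R' assume "R' \<in> {R}"
    moreover have "(\<one>\<^bsub>G\<^esub>, s) \<in> R" if "s \<in> S" for s
      using that P R.cone_iff semigroup_generated.gen_incl by metis
    ultimately show "R' \<in> ?U S" using lo by simp
  qed
  ultimately show ?thesis using lo by (simp add: isolated_ordering_def)
qed


section \<open>Normal forms in amalgamated products\<close>

text \<open>The pair \<open>(h, [(a\<^sub>1, b\<^sub>1), \<dots>, (a\<^sub>n, b\<^sub>n)])\<close> encodes the normal form \<open>h a\<^sub>1 b\<^sub>1 \<dots> a\<^sub>n b\<^sub>n\<close>, where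
  \<open>A\<close> and \<open>B\<close> are transversals of the right cosets of \<open>C\<close>, both containing \<open>\<one>\<close>; only the last \<open>b\<^sub>i\<close> may be
  trivial.\<close>

locale amalgam_transversals = amalgam_data C f G k H
  for C :: "('c, 'x) monoid_scheme" and f :: "'c \<Rightarrow> 'a" and G :: "('a, 'y) monoid_scheme"
    and k :: "'c \<Rightarrow> 'b" and H :: "('b, 'w) monoid_scheme" +
  fixes A :: "'a set" and B :: "'b set"
  assumes bij_A: "bij_betw (\<lambda>(c, a). f c \<otimes>\<^bsub>G\<^esub> a) (carrier C \<times> A) (carrier G)"
    and bij_B: "bij_betw (\<lambda>(c, b). k c \<otimes>\<^bsub>H\<^esub> b) (carrier C \<times> B) (carrier H)"
    and A_closed: "A \<subseteq> carrier G" and B_closed: "B \<subseteq> carrier H"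
    and one_A: "\<one>\<^bsub>G\<^esub> \<in> A" and one_B: "\<one>\<^bsub>H\<^esub> \<in> B"
begin

sublocale X: group X by (rule group_amalg)
sublocale inl: group_hom G X inl by unfold_locales (rule inl_hom)
sublocale inr: group_hom H X inr by unfold_locales (rule inr_hom)

declare subsetD[OF A_closed, simp] subsetD[OF B_closed, simp]

definition split_G :: "'a \<Rightarrow> 'c \<times> 'a" where
  "split_G = inv_into (carrier C \<times> A) (\<lambda>(c, a). f c \<otimes>\<^bsub>G\<^esub> a)"

definition split_H :: "'b \<Rightarrow> 'c \<times> 'b" where
  "split_H = inv_into (carrier C \<times> B) (\<lambda>(c, b). k c \<otimes>\<^bsub>H\<^esub> b)"

lemma split_G_mult: "c \<in> carrier C \<Longrightarrow> a \<in> A \<Longrightarrow> split_G (f c \<otimes>\<^bsub>G\<^esub> a) = (c, a)"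
  unfolding split_G_def using bij_betw_inv_into_left[OF bij_A, of "(c, a)"] by simp

lemma split_H_mult: "c \<in> carrier C \<Longrightarrow> b \<in> B \<Longrightarrow> split_H (k c \<otimes>\<^bsub>H\<^esub> b) = (c, b)"
  unfolding split_H_def using bij_betw_inv_into_left[OF bij_B, of "(c, b)"] by simp

lemma split_GE:
  assumes "g \<in> carrier G"
  obtains c a where "c \<in> carrier C" "a \<in> A" "g = f c \<otimes>\<^bsub>G\<^esub> a" "split_G g = (c, a)"
proof -
  have "g \<in> (\<lambda>(c, a). f c \<otimes>\<^bsub>G\<^esub> a) ` (carrier C \<times> A)"
    using assms bij_betw_imp_surj_on[OF bij_A] by blast
  then obtain c a where "c \<in> carrier C" "a \<in> A" "g = f c \<otimes>\<^bsub>G\<^esub> a" by fast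
  then show thesis using that split_G_mult by blast
qed

lemma split_HE:
  assumes "h \<in> carrier H"
  obtains c b where "c \<in> carrier C" "b \<in> B" "h = k c \<otimes>\<^bsub>H\<^esub> b" "split_H h = (c, b)"
proof -
  have "h \<in> (\<lambda>(c, b). k c \<otimes>\<^bsub>H\<^esub> b) ` (carrier C \<times> B)"
    using assms bij_betw_imp_surj_on[OF bij_B] by blast
  then obtain c b where "c \<in> carrier C" "b \<in> B" "h = k c \<otimes>\<^bsub>H\<^esub> b" by fast
  then show thesis using that split_H_mult by blast
qed

section \<open>Normal forms with leading letter in \<open>H\<close> or in \<open>G\<close>\<close>

fun syllables :: "('a \<times> 'b) list \<Rightarrow> bool" where
  "syllables [] \<longleftrightarrow> True"
| "syllables ((a, b) # l) \<longleftrightarrow> a \<in> A \<and> a \<noteq> \<one>\<^bsub>G\<^esub> \<and> b \<in> B \<and> (b \<noteq> \<one>\<^bsub>H\<^esub> \<or> l = []) \<and> syllables l"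

definition H_forms :: "('b \<times> ('a \<times> 'b) list) set" where
  "H_forms = {(h, l). h \<in> carrier H \<and> syllables l}"

text \<open>A triple encodes g b a_1 b_1 ... a_n b_n, with the leading letter in \<open>G\<close>.
  On these forms \<open>G\<close> acts by multiplying the first component, as \<open>H\<close> does
  on \<open>H_forms\<close>.\<close>

definition G_forms :: "('a \<times> 'b \<times> ('a \<times> 'b) list) set" where
  "G_forms = {(g, b, l). g \<in> carrier G \<and> b \<in> B \<and> (b \<noteq> \<one>\<^bsub>H\<^esub> \<or> l = []) \<and> syllables l}"

text \<open>Split h = k(c) b and move k(c) = f(c) to the \<open>G\<close> side. If b is trivial and
  syllables follow, the next letter from \<open>A\<close> is absorbed into the leading letter, so
  that no trivial b separates two letters of \<open>G\<close>.\<close>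

fun to_G :: "'b \<times> ('a \<times> 'b) list \<Rightarrow> 'a \<times> 'b \<times> ('a \<times> 'b) list" where
  "to_G (h, l) = (let (c, b) = split_H h in
     case l of [] \<Rightarrow> (f c, b, [])
     | (a, b') # l' \<Rightarrow> if b = \<one>\<^bsub>H\<^esub> then (f c \<otimes>\<^bsub>G\<^esub> a, b', l') else (f c, b, l))"

fun to_H :: "'a \<times> 'b \<times> ('a \<times> 'b) list \<Rightarrow> 'b \<times> ('a \<times> 'b) list" where
  "to_H (g, b, l) = (let (c, a) = split_G g in
     if a = \<one>\<^bsub>G\<^esub> then (k c \<otimes>\<^bsub>H\<^esub> b, l) else (k c, (a, b) # l))"

lemma split_H_hom: "c \<in> carrier C \<Longrightarrow> split_H (k c) = (c, \<one>\<^bsub>H\<^esub>)"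
  using split_H_mult[of c "\<one>\<^bsub>H\<^esub>"] one_B by simp

lemma split_G_hom: "c \<in> carrier C \<Longrightarrow> split_G (f c) = (c, \<one>\<^bsub>G\<^esub>)"
  using split_G_mult[of c "\<one>\<^bsub>G\<^esub>"] one_A by simp

text \<open>Uniqueness of the coset splittings makes the conversion reversible: splitting f(c) or
  f(c) a recovers exactly what was moved.\<close>

lemma to_G:
  assumes "\<nu> \<in> H_forms"
  shows "to_G \<nu> \<in> G_forms" and "to_H (to_G \<nu>) = \<nu>"
proof -
  obtain h l where \<nu>: "\<nu> = (h, l)" "h \<in> carrier H" "syllables l"
    using assms by (auto simp: H_forms_def)
  obtain c b where cb: "c \<in> carrier C" "b \<in> B" "h = k c \<otimes>\<^bsub>H\<^esub> b" "split_H h = (c, b)"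
    using split_HE[OF \<nu>(2)] .
  have cl: "f c \<in> carrier G" "k c \<in> carrier H" using cb(1) by simp_all
  have "to_G \<nu> \<in> G_forms \<and> to_H (to_G \<nu>) = \<nu>"
  proof (cases l)
    case Nil
    then show ?thesis using \<nu> cb cl by (simp add: G_forms_def split_G_hom)
  next
    case (Cons s l')
    obtain a b' where s: "s = (a, b')" by fastforce
    have "a \<in> carrier G" using \<nu>(3) A_closed by (auto simp: Cons s)
    then show ?thesis
      using \<nu> cb cl by (auto simp: G_forms_def split_G_hom split_G_mult Cons s)
  qed
  then show "to_G \<nu> \<in> G_forms" "to_H (to_G \<nu>) = \<nu>" by auto
qed

lemma to_H:
  assumes "\<mu> \<in> G_forms"
  shows "to_H \<mu> \<in> H_forms" and "to_G (to_H \<mu>) = \<mu>"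
proof -
  obtain g b l where \<mu>: "\<mu> = (g, b, l)" "g \<in> carrier G" "b \<in> B" "b \<noteq> \<one>\<^bsub>H\<^esub> \<or> l = []" "syllables l"
    using assms by (auto simp: G_forms_def)
  obtain c a where ca: "c \<in> carrier C" "a \<in> A" "g = f c \<otimes>\<^bsub>G\<^esub> a" "split_G g = (c, a)"
    using split_GE[OF \<mu>(2)] .
  have cl: "f c \<in> carrier G" "k c \<in> carrier H" "b \<in> carrier H"
    using ca(1) \<mu>(3) B_closed by auto
  have "to_H \<mu> \<in> H_forms \<and> to_G (to_H \<mu>) = \<mu>"
  proof (cases "a = \<one>\<^bsub>G\<^esub>")
    case True
    then show ?thesis
      using \<mu> ca cl by (cases l) (auto simp: H_forms_def split_H_mult)
  next
    case False
    then show ?thesis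
      using \<mu> ca cl by (simp add: H_forms_def split_H_hom)
  qed
  then show "to_H \<mu> \<in> H_forms" "to_G (to_H \<mu>) = \<mu>" by auto
qed

section \<open>The action of the amalgamated product on normal forms\<close>

fun act_G :: "'a \<Rightarrow> 'b \<times> ('a \<times> 'b) list \<Rightarrow> 'b \<times> ('a \<times> 'b) list" where
  "act_G g \<nu> = (case to_G \<nu> of (g', \<mu>) \<Rightarrow> to_H (g \<otimes>\<^bsub>G\<^esub> g', \<mu>))"

fun act_H :: "'b \<Rightarrow> 'b \<times> ('a \<times> 'b) list \<Rightarrow> 'b \<times> ('a \<times> 'b) list" where
  "act_H h (h', l) = (h \<otimes>\<^bsub>H\<^esub> h', l)"

lemma G_forms_mult: "g \<in> carrier G \<Longrightarrow> (g', \<mu>) \<in> G_forms \<Longrightarrow> (g \<otimes>\<^bsub>G\<^esub> g', \<mu>) \<in> G_forms"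
  by (cases \<mu>) (auto simp: G_forms_def)

lemma act_G_closed: "g \<in> carrier G \<Longrightarrow> \<nu> \<in> H_forms \<Longrightarrow> act_G g \<nu> \<in> H_forms"
  using to_G(1)[of \<nu>] to_H(1) G_forms_mult by (cases "to_G \<nu>") auto

lemma act_G_mult:
  assumes "g \<in> carrier G" "g' \<in> carrier G" "\<nu> \<in> H_forms"
  shows "act_G g (act_G g' \<nu>) = act_G (g \<otimes>\<^bsub>G\<^esub> g') \<nu>"
proof -
  obtain a \<mu> where \<nu>: "to_G \<nu> = (a, \<mu>)" by (cases "to_G \<nu>")
  then have a: "(a, \<mu>) \<in> G_forms" using to_G(1)[OF assms(3)] by simp
  then have "a \<in> carrier G" by (auto simp: G_forms_def)
  then show ?thesis
    using \<nu> to_H(2)[OF G_forms_mult[OF assms(2) a]] assms by (simp add: G.m_assoc del: to_H.simps to_G.simps)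
qed

lemma act_G_one:
  assumes "\<nu> \<in> H_forms"
  shows "act_G \<one>\<^bsub>G\<^esub> \<nu> = \<nu>"
proof -
  obtain a b l where \<nu>: "to_G \<nu> = (a, b, l)" by (cases "to_G \<nu>")
  then have "a \<in> carrier G" using to_G(1)[OF assms] by (auto simp: G_forms_def)
  then show ?thesis using \<nu> to_G(2)[OF assms] by (simp del: to_H.simps to_G.simps)
qed

text \<open>Multiplying h = k(d) b by k(c) changes only the coset part, to k(cd), and leaves b
  alone. So \<open>to_G\<close> takes the same branch before and after, with its leading letter
  multiplied by f(c).\<close>

lemma act_glue:
  assumes c: "c \<in> carrier C" and \<nu>: "\<nu> \<in> H_forms"
  shows "act_G (f c) \<nu> = act_H (k c) \<nu>"
proof -
  obtain h l where hl: "\<nu> = (h, l)" "h \<in> carrier H" "syllables l"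
    using \<nu> by (auto simp: H_forms_def)
  obtain d b where db: "d \<in> carrier C" "b \<in> B" "h = k d \<otimes>\<^bsub>H\<^esub> b" "split_H h = (d, b)"
    using split_HE[OF hl(2)] .
  have cl: "k c \<in> carrier H" "k d \<in> carrier H" "b \<in> carrier H" "f c \<in> carrier G" "f d \<in> carrier G"
    using c db B_closed by auto
  have eq: "k c \<otimes>\<^bsub>H\<^esub> h = k (c \<otimes>\<^bsub>C\<^esub> d) \<otimes>\<^bsub>H\<^esub> b"
    using c db cl by (simp add: H.m_assoc)
  have s: "split_H (k c \<otimes>\<^bsub>H\<^esub> h) = (c \<otimes>\<^bsub>C\<^esub> d, b)"
    unfolding eq using c db by (intro split_H_mult) simp_all
  have "to_G (act_H (k c) \<nu>) = (case to_G \<nu> of (g', \<mu>) \<Rightarrow> (f c \<otimes>\<^bsub>G\<^esub> g', \<mu>))"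
  proof (cases l)
    case (Cons p l')
    obtain a b' where p: "p = (a, b')" by fastforce
    have "a \<in> carrier G" using hl(3) A_closed by (auto simp: Cons p)
    then show ?thesis using s hl c db cl by (simp add: Cons p G.m_assoc)
  qed (use s hl c db in simp)
  moreover have "act_H (k c) \<nu> \<in> H_forms" using hl cl by (simp add: H_forms_def)
  ultimately show ?thesis
    using to_G(2)[of "act_H (k c) \<nu>"] by (cases "to_G \<nu>") (simp del: to_H.simps to_G.simps)
qed

abbreviation act_word :: "('a + 'b) list \<Rightarrow> 'b \<times> ('a \<times> 'b) list \<Rightarrow> 'b \<times> ('a \<times> 'b) list" where
  "act_word \<equiv> foldr (case_sum act_G act_H)"

lemma act_H_closed: "h \<in> carrier H \<Longrightarrow> \<nu> \<in> H_forms \<Longrightarrow> act_H h \<nu> \<in> H_forms"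
  by (cases \<nu>) (simp add: H_forms_def)

lemma act_word_closed: "w \<in> W \<Longrightarrow> \<nu> \<in> H_forms \<Longrightarrow> act_word w \<nu> \<in> H_forms"
  by (induction w) (auto simp del: act_G.simps intro: act_G_closed act_H_closed)

text \<open>Each defining relation of the amalgam holds for the actions on normal forms, so the
  actions of the two factors fit together to one of \<open>X\<close>.\<close>

lemma act_word_cong: "(u, v) \<in> E \<Longrightarrow> \<nu> \<in> H_forms \<Longrightarrow> act_word u \<nu> = act_word v \<nu>"
proof (induction arbitrary: \<nu> rule: amalg_rel.induct)
  case (word_append u u' v v')
  then show ?case using rel_words act_word_closed by simp
next
  case (one_right)
  then show ?case by (auto simp: H_forms_def)
next
  case (mult_right a b)
  then show ?case by (cases \<nu>) (simp add: H_forms_def H.m_assoc)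
qed (simp_all del: act_G.simps add: act_G_one act_G_mult act_glue)

text \<open>The representative is arbitrary; on \<open>H_forms\<close> its choice does not matter,
  by \<open>act_word_cong\<close>.\<close>

definition act :: "('a + 'b) list set \<Rightarrow> 'b \<times> ('a \<times> 'b) list \<Rightarrow> 'b \<times> ('a \<times> 'b) list" where
  "act x = act_word (SOME w. w \<in> x)"

lemma act_class:
  assumes "w \<in> W" "\<nu> \<in> H_forms"
  shows "act (E `` {w}) \<nu> = act_word w \<nu>"
proof -
  have "w \<in> E `` {w}" using assms by (auto intro: amalg_rel.word_refl)
  then have "(SOME w'. w' \<in> E `` {w}) \<in> E `` {w}" by (rule someI)
  then have "(w, SOME w'. w' \<in> E `` {w}) \<in> E" by (simp only: Image_singleton_iff)
  then show ?thesis unfolding act_def using act_word_cong[OF _ assms(2)] by metis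
qed

lemma act_one: "\<nu> \<in> H_forms \<Longrightarrow> act \<one>\<^bsub>X\<^esub> \<nu> = \<nu>"
  using act_class[of "[]"] by (simp add: one_amalg)

lemma act_mult:
  assumes "x \<in> carrier X" "y \<in> carrier X" "\<nu> \<in> H_forms"
  shows "act (x \<otimes>\<^bsub>X\<^esub> y) \<nu> = act x (act y \<nu>)"
proof -
  obtain u where u: "u \<in> W" "x = E `` {u}" using assms(1) by (rule carrier_amalgE)
  obtain v where v: "v \<in> W" "y = E `` {v}" using assms(2) by (rule carrier_amalgE)
  have "u @ v \<in> W" using u v by simp
  then show ?thesis
    using u v assms(3) act_word_closed[OF v(1) assms(3)] by (simp only: mult_class act_class foldr_append o_apply)
qed

lemma act_inl: "g \<in> carrier G \<Longrightarrow> \<nu> \<in> H_forms \<Longrightarrow> act (inl g) \<nu> = act_G g \<nu>"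
  using act_class[of "[Inl g]" \<nu>] by (simp add: amalg_inl_def InlI del: act_G.simps)

lemma act_inr: "h \<in> carrier H \<Longrightarrow> \<nu> \<in> H_forms \<Longrightarrow> act (inr h) \<nu> = act_H h \<nu>"
  using act_class[of "[Inr h]" \<nu>] by (simp add: amalg_inr_def InrI)

section \<open>Evaluation of normal forms\<close>

fun tail_value :: "('a \<times> 'b) list \<Rightarrow> ('a + 'b) list set" where
  "tail_value [] = \<one>\<^bsub>X\<^esub>"
| "tail_value ((a, b) # l) = inl a \<otimes>\<^bsub>X\<^esub> (inr b \<otimes>\<^bsub>X\<^esub> tail_value l)"

fun form_value :: "'b \<times> ('a \<times> 'b) list \<Rightarrow> ('a + 'b) list set" where
  "form_value (h, l) = inr h \<otimes>\<^bsub>X\<^esub> tail_value l"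

lemma tail_value_closed: "syllables l \<Longrightarrow> tail_value l \<in> carrier X"
  by (induction l rule: syllables.induct) auto

lemma form_value_closed: "\<nu> \<in> H_forms \<Longrightarrow> form_value \<nu> \<in> carrier X"
  by (cases \<nu>) (simp add: H_forms_def tail_value_closed)

lemma form_value_to_H:
  assumes "(g, b, l) \<in> G_forms"
  shows "form_value (to_H (g, b, l)) = inl g \<otimes>\<^bsub>X\<^esub> (inr b \<otimes>\<^bsub>X\<^esub> tail_value l)"
proof -
  have gbl: "g \<in> carrier G" "b \<in> carrier H" "syllables l"
    using assms B_closed by (auto simp: G_forms_def)
  obtain c a where ca: "c \<in> carrier C" "a \<in> A" "g = f c \<otimes>\<^bsub>G\<^esub> a" "split_G g = (c, a)"
    using split_GE[OF gbl(1)] .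
  have "a \<in> carrier G" "f c \<in> carrier G" "k c \<in> carrier H" using ca A_closed by auto
  then show ?thesis
    using ca gbl tail_value_closed[OF gbl(3)] inl_inr_glue[OF ca(1)]
    by (auto simp: X.m_assoc)
qed

lemma form_value_act_G:
  assumes "g \<in> carrier G" "\<nu> \<in> H_forms"
  shows "form_value (act_G g \<nu>) = inl g \<otimes>\<^bsub>X\<^esub> form_value \<nu>"
proof -
  obtain a b l where \<nu>: "to_G \<nu> = (a, b, l)" by (cases "to_G \<nu>")
  then have f: "(a, b, l) \<in> G_forms" using to_G(1)[OF assms(2)] by simp
  then have cl: "a \<in> carrier G" "b \<in> carrier H" "tail_value l \<in> carrier X"
    using B_closed tail_value_closed by (auto simp: G_forms_def)
  have "form_value \<nu> = inl a \<otimes>\<^bsub>X\<^esub> (inr b \<otimes>\<^bsub>X\<^esub> tail_value l)"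
    using form_value_to_H[OF f] to_G(2)[OF assms(2)] \<nu> by simp
  moreover have "form_value (act_G g \<nu>) = inl (g \<otimes>\<^bsub>G\<^esub> a) \<otimes>\<^bsub>X\<^esub> (inr b \<otimes>\<^bsub>X\<^esub> tail_value l)"
    using form_value_to_H[OF G_forms_mult[OF assms(1) f]] \<nu> by (simp del: to_H.simps to_G.simps)
  ultimately show ?thesis using cl assms(1) by (simp add: X.m_assoc)
qed

lemma form_value_act_H:
  "h \<in> carrier H \<Longrightarrow> \<nu> \<in> H_forms \<Longrightarrow> form_value (act_H h \<nu>) = inr h \<otimes>\<^bsub>X\<^esub> form_value \<nu>"
  by (cases \<nu>) (simp add: H_forms_def tail_value_closed X.m_assoc)

lemma form_value_act_word:
  "w \<in> W \<Longrightarrow> \<nu> \<in> H_forms \<Longrightarrow> form_value (act_word w \<nu>) = E `` {w} \<otimes>\<^bsub>X\<^esub> form_value \<nu>"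
proof (induction w)
  case Nil
  then show ?case by (simp add: one_amalg[symmetric] form_value_closed)
next
  case (Cons s w)
  then have sw: "[s] \<in> W" "w \<in> W" by simp_all
  have IH: "form_value (act_word w \<nu>) = E `` {w} \<otimes>\<^bsub>X\<^esub> form_value \<nu>" using Cons sw by blast
  have "form_value (act_word (s # w) \<nu>) = E `` {[s]} \<otimes>\<^bsub>X\<^esub> form_value (act_word w \<nu>)"
  proof (cases s)
    case (Inl a)
    then have "a \<in> carrier G" using sw(1) by auto
    then show ?thesis
      using form_value_act_G[OF _ act_word_closed[OF sw(2) Cons.prems(2)]]
      by (simp add: Inl amalg_inl_def del: act_G.simps form_value.simps)
  next
    case (Inr b)
    then have "b \<in> carrier H" using sw(1) by auto
    then show ?thesis
      using form_value_act_H[OF _ act_word_closed[OF sw(2) Cons.prems(2)]]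
      by (simp add: Inr amalg_inr_def del: act_H.simps form_value.simps)
  qed
  moreover have "E `` {s # w} = E `` {[s]} \<otimes>\<^bsub>X\<^esub> E `` {w}"
    using mult_class[OF sw] by simp
  ultimately show ?case
    using IH class_closed[OF sw(1)] class_closed[OF sw(2)] form_value_closed[OF Cons.prems(2)]
    by (simp only: X.m_assoc)
qed

text \<open>A form of x arises when a word for x acts on the trivial form: evaluation is
  equivariant, and the trivial form evaluates to 1.\<close>

theorem normal_form_exists:
  assumes "x \<in> carrier X"
  obtains \<nu> where "\<nu> \<in> H_forms" "x = form_value \<nu>"
proof -
  obtain w where w: "w \<in> W" "x = E `` {w}" using assms by (rule carrier_amalgE)
  have 1: "(\<one>\<^bsub>H\<^esub>, []) \<in> H_forms" by (simp add: H_forms_def)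
  show thesis
    using that[OF act_word_closed[OF w(1) 1]] form_value_act_word[OF w(1) 1] w(2) assms by simp
qed

end


section \<open>The ordering of the amalgamated product\<close>

text \<open>Generating sets are absent on purpose: what is retained of them is the cofinality of
  \<open>zG\<close> and \<open>zH\<close> and the least positive elements \<open>g1\<close> and
  \<open>h1\<close> below these. The ordering built here therefore cannot depend on
  generators.\<close>

locale ordered_amalgam =
  G: left_ordered_group G RG + H: left_ordered_group H RH
  for G :: "('a, 'c) monoid_scheme" and RG :: "'a rel"
    and H :: "('b, 'd) monoid_scheme" and RH :: "'b rel" +
  fixes zG g1 :: 'a and zH h1 :: 'b
  assumes cofinal_zG: "cofinal_elt G RG zG"
    and central: "\<And>g. g \<in> carrier G \<Longrightarrow> zG \<otimes>\<^bsub>G\<^esub> g = g \<otimes>\<^bsub>G\<^esub> zG"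
    and cofinal_zH: "cofinal_elt H RH zH"
    and right_invariant_zH: "right_invariant H RH zH"
    and g1: "g1 \<in> positive_cone G RG" "\<And>p. p \<in> positive_cone G RG \<Longrightarrow> p = g1 \<or> (g1, p) \<in> RG"
      "(g1, zG) \<in> RG"
    and h1: "h1 \<in> positive_cone H RH" "\<And>p. p \<in> positive_cone H RH \<Longrightarrow> p = h1 \<or> (h1, p) \<in> RH"
      "(h1, zH) \<in> RH"
begin

lemma z_pos: "zG \<in> G.P" "zH \<in> H.P"
  using g1(1,3) h1(1,3) G.less_trans H.less_trans by (auto simp: G.cone_iff H.cone_iff)

lemma closed [simp]: "zG \<in> carrier G" "zH \<in> carrier H" "g1 \<in> carrier G" "h1 \<in> carrier H"
  using z_pos g1(1) h1(1) G.cone_closed H.cone_closed by auto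

text \<open>The intervals are [1, z) in \<open>G\<close> but (z^-1, 1] in \<open>H\<close>, so
  nontrivial letters from the first transversal are positive and those from the second
  negative.\<close>

sublocale amalgam_transversals integer_group "\<lambda>n. zG [^]\<^bsub>G\<^esub> n" G "\<lambda>n. zH [^]\<^bsub>H\<^esub> n" H
  "{a. a = \<one>\<^bsub>G\<^esub> \<or> (\<one>\<^bsub>G\<^esub>, a) \<in> RG \<and> (a, zG) \<in> RG}"
  "{b. b = \<one>\<^bsub>H\<^esub> \<or> (inv\<^bsub>H\<^esub> zH, b) \<in> RH \<and> (b, \<one>\<^bsub>H\<^esub>) \<in> RH}"
proof (intro amalgam_transversals.intro amalgam_transversals_axioms.intro)
  show "amalgam_data integer_group (\<lambda>n. zG [^]\<^bsub>G\<^esub> n) G (\<lambda>n. zH [^]\<^bsub>H\<^esub> n) H"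
    by (rule cyclic_amalgam_data) simp_all
qed (use G.less_closed H.less_closed G.bij_betw_floor[OF z_pos(1) cofinal_zG]
    H.bij_betw_ceiling[OF z_pos(2) cofinal_zH] in auto)

section \<open>The candidate positive cone\<close>

definition z :: "('a + 'b) list set" where "z = inl zG"

lemma z_eq: "z = inr zH"
  using inl_inr_glue[of 1] by (simp add: z_def)

lemma z_closed [simp]: "z \<in> carrier X"
  by (simp add: z_def)

definition twist :: "'a \<Rightarrow> ('a + 'b) list set" where
  "twist g = inl g \<otimes>\<^bsub>X\<^esub> inv\<^bsub>X\<^esub> (inr zH) \<otimes>\<^bsub>X\<^esub> inr h1"

lemma twist_closed [simp]: "g \<in> carrier G \<Longrightarrow> twist g \<in> carrier X"
  by (simp add: twist_def)

definition cone :: "('a + 'b) list set set" where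
  "cone = semigroup_generated X (twist ` G.P \<union> inr ` H.P)"

lemma cone_mult: "x \<in> cone \<Longrightarrow> y \<in> cone \<Longrightarrow> x \<otimes>\<^bsub>X\<^esub> y \<in> cone"
  unfolding cone_def by (rule semigroup_generated.gen_mult)

lemma twist_cone: "g \<in> G.P \<Longrightarrow> twist g \<in> cone"
  unfolding cone_def by (auto intro: semigroup_generated.gen_incl)

lemma inr_cone: "h \<in> H.P \<Longrightarrow> inr h \<in> cone"
  unfolding cone_def by (auto intro: semigroup_generated.gen_incl)

lemma cone_closed: "x \<in> cone \<Longrightarrow> x \<in> carrier X"
proof -
  have "cone \<subseteq> carrier X"
    unfolding cone_def using G.cone_closed H.cone_closed by (intro semigroup_generated_least) auto
  then show "x \<in> cone \<Longrightarrow> x \<in> carrier X" by auto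
qed

lemma gap_cone: "inv\<^bsub>H\<^esub> h1 \<otimes>\<^bsub>H\<^esub> zH \<in> H.P"
  using h1(3) by (simp add: H.less_iff_cone[symmetric])

lemma inv_h1_mult: "p \<in> H.P \<Longrightarrow> inv\<^bsub>H\<^esub> h1 \<otimes>\<^bsub>H\<^esub> p = \<one>\<^bsub>H\<^esub> \<or> inv\<^bsub>H\<^esub> h1 \<otimes>\<^bsub>H\<^esub> p \<in> H.P"
  using h1(2)[of p] H.less_iff_cone[of h1 p] H.cone_closed[of p] by auto

text \<open>Solves the definition of x_g for g. The factor h_1^-1 z is positive by
  \<open>gap_cone\<close>, so positive elements of \<open>G\<close> land in
  \<open>cone\<close>.\<close>

lemma inl_eq: "g \<in> carrier G \<Longrightarrow> inl g = twist g \<otimes>\<^bsub>X\<^esub> inr (inv\<^bsub>H\<^esub> h1 \<otimes>\<^bsub>H\<^esub> zH)"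
  by (simp add: twist_def X.m_assoc)

lemma inl_cone: "g \<in> G.P \<Longrightarrow> inl g \<in> cone"
  using inl_eq twist_cone inr_cone[OF gap_cone] cone_mult G.cone_closed by simp

lemma inl_mult_twist: "g \<in> carrier G \<Longrightarrow> g' \<in> carrier G \<Longrightarrow> inl g \<otimes>\<^bsub>X\<^esub> twist g' = twist (g \<otimes>\<^bsub>G\<^esub> g')"
  by (simp add: twist_def X.m_assoc)

lemma twist_mult:
  "g \<in> carrier G \<Longrightarrow> g' \<in> carrier G \<Longrightarrow>
    twist (g \<otimes>\<^bsub>G\<^esub> g') = twist g \<otimes>\<^bsub>X\<^esub> (inr (inv\<^bsub>H\<^esub> h1 \<otimes>\<^bsub>H\<^esub> zH) \<otimes>\<^bsub>X\<^esub> twist g')"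
  using inl_mult_twist[of g g'] inl_eq[of g] by (simp add: X.m_assoc)

text \<open>Rests on x_(ab) = x_a (h_1^-1 z) x_b, whose middle factor is positive in
  \<open>H\<close>: every x_g with g positive becomes a product of elements x_s with s in
  \<open>S\<close> and elements of \<open>T\<close>.\<close>

lemma cone_eq_generated:
  assumes S: "G.P = semigroup_generated G S" and T: "H.P = semigroup_generated H T"
  shows "cone = semigroup_generated X (twist ` S \<union> inr ` T)" (is "_ = ?M")
proof
  have inr: "inr h \<in> ?M" if "h \<in> semigroup_generated H T" for h
    using that
  proof induction
    case (gen_mult a b)
    then have "a \<in> carrier H" "b \<in> carrier H" using T H.cone_closed by auto
    then show ?case using gen_mult semigroup_generated.gen_mult by (simp add: inr.hom_mult)
  qed (auto intro: semigroup_generated.gen_incl)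
  have "twist g \<in> ?M" if "g \<in> semigroup_generated G S" for g
    using that
  proof induction
    case (gen_mult a b)
    then have ab: "a \<in> carrier G" "b \<in> carrier G" using S G.cone_closed by auto
    show ?case
      unfolding twist_mult[OF ab]
      by (rule semigroup_generated.gen_mult[OF gen_mult.IH(1)
            semigroup_generated.gen_mult[OF inr[OF gap_cone[unfolded T]] gen_mult.IH(2)]])
  qed (auto intro: semigroup_generated.gen_incl)
  with inr show "cone \<subseteq> ?M"
    unfolding cone_def S T by (intro semigroup_generated_least semigroup_generated.gen_mult) auto
  have "S \<subseteq> G.P" "T \<subseteq> H.P" using S T by (auto intro: semigroup_generated.gen_incl)
  then show "?M \<subseteq> cone"
    using twist_cone inr_cone cone_mult by (intro semigroup_generated_least) auto
qed

section \<open>Every nontrivial element or its inverse lies in the cone\<close>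

lemma twist_mult_inr:
  assumes "g \<in> G.P" "p \<in> H.P"
  shows "twist g \<otimes>\<^bsub>X\<^esub> inr (inv\<^bsub>H\<^esub> h1 \<otimes>\<^bsub>H\<^esub> p) \<in> cone"
  using inv_h1_mult[OF assms(2)]
proof
  assume "inv\<^bsub>H\<^esub> h1 \<otimes>\<^bsub>H\<^esub> p = \<one>\<^bsub>H\<^esub>"
  then show ?thesis using assms twist_cone G.cone_closed by (simp del: inr.hom_mult)
qed (use assms twist_cone inr_cone cone_mult in blast)

text \<open>Syllables are stripped from the left: a b = x_a b' with b' = h_1^-1 z b, and b' >= 1
  because zb is positive and so at least \<open>h1\<close>. What remains is a form with head b' >=
  1, hence the induction over arbitrary heads.\<close>

lemma form_value_cone:
  assumes "syllables l" "h = \<one>\<^bsub>H\<^esub> \<or> h \<in> H.P" "(h, l) \<noteq> (\<one>\<^bsub>H\<^esub>, [])"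
  shows "form_value (h, l) \<in> cone"
  using assms
proof (induction l arbitrary: h)
  case Nil
  then show ?case using inr_cone H.cone_closed by auto
next
  case (Cons s l)
  obtain a b where s: "s = (a, b)" by (cases s)
  have a: "a \<in> G.P" and b: "b = \<one>\<^bsub>H\<^esub> \<or> (inv\<^bsub>H\<^esub> zH, b) \<in> RH" and l: "syllables l"
    using Cons.prems(1) by (auto simp: s G.cone_iff)
  have bc: "b \<in> carrier H" using b H.less_closed by auto
  have ac: "a \<in> carrier G" using a by (rule G.cone_closed)
  define b' where "b' = inv\<^bsub>H\<^esub> h1 \<otimes>\<^bsub>H\<^esub> (zH \<otimes>\<^bsub>H\<^esub> b)"
  have "zH \<otimes>\<^bsub>H\<^esub> b \<in> H.P"
    using b H.less_iff_cone[of "inv\<^bsub>H\<^esub> zH" b] bc z_pos by auto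
  then have b': "b' = \<one>\<^bsub>H\<^esub> \<or> b' \<in> H.P" unfolding b'_def by (rule inv_h1_mult)
  have b'c: "b' \<in> carrier H" using bc by (simp add: b'_def)
  have "inr b = inr (inv\<^bsub>H\<^esub> zH \<otimes>\<^bsub>H\<^esub> h1) \<otimes>\<^bsub>X\<^esub> inr b'"
    using bc by (simp add: b'_def X.m_assoc)
  then have eq: "tail_value (s # l) = twist a \<otimes>\<^bsub>X\<^esub> form_value (b', l)"
    using ac bc b'c tail_value_closed[OF l] by (simp add: s twist_def X.m_assoc)
  have tail: "tail_value (s # l) \<in> cone"
  proof (cases "(b', l) = (\<one>\<^bsub>H\<^esub>, [])")
    case True
    then show ?thesis using eq twist_cone[OF a] ac by simp
  next
    case False
    then show ?thesis using eq Cons.IH[OF l b'] twist_cone[OF a] cone_mult by metis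
  qed
  then show ?case using Cons.prems(2) inr_cone cone_mult cone_closed by auto
qed

text \<open>Inverting reverses the word, and the trailing p feeds the next step: (a b t)^-1 p =
  (t^-1 b^-1) (a^-1 p). The second factor is x_(a') h_1^-1 p with a' = a^-1 z positive; the first is
  the induction hypothesis for b^-1.\<close>

lemma inv_tail_value_cone:
  assumes "syllables l" "p \<in> H.P"
  shows "inv\<^bsub>X\<^esub> (tail_value l) \<otimes>\<^bsub>X\<^esub> inr p \<in> cone"
  using assms
proof (induction l arbitrary: p)
  case Nil
  then show ?case using inr_cone H.cone_closed by auto
next
  case (Cons s l)
  obtain a b where s: "s = (a, b)" by (cases s)
  have a: "(a, zG) \<in> RG" and b: "b = \<one>\<^bsub>H\<^esub> \<and> l = [] \<or> (b, \<one>\<^bsub>H\<^esub>) \<in> RH" and l: "syllables l"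
    using Cons.prems(1) by (auto simp: s)
  have ac: "a \<in> carrier G" using a G.less_closed by auto
  have bc: "b \<in> carrier H" using b H.less_closed by auto
  have pc: "p \<in> carrier H" using Cons.prems(2) by (rule H.cone_closed)
  have tc: "tail_value l \<in> carrier X" using l by (rule tail_value_closed)
  define a' where "a' = inv\<^bsub>G\<^esub> a \<otimes>\<^bsub>G\<^esub> zG"
  have a': "a' \<in> G.P" using a G.less_iff_cone[OF ac closed(1)] by (simp add: a'_def)
  have a'c: "a' \<in> carrier G" using ac by (simp add: a'_def)
  have "inl (inv\<^bsub>G\<^esub> a) \<otimes>\<^bsub>X\<^esub> inr p = twist a' \<otimes>\<^bsub>X\<^esub> inr (inv\<^bsub>H\<^esub> h1 \<otimes>\<^bsub>H\<^esub> p)"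
    using ac a'c pc z_eq by (simp add: twist_def a'_def X.m_assoc z_def)
  then have ap: "inl (inv\<^bsub>G\<^esub> a) \<otimes>\<^bsub>X\<^esub> inr p \<in> cone"
    using twist_mult_inr[OF a' Cons.prems(2)] by simp
  have eq: "inv\<^bsub>X\<^esub> (tail_value (s # l)) \<otimes>\<^bsub>X\<^esub> inr p =
      (inv\<^bsub>X\<^esub> (tail_value l) \<otimes>\<^bsub>X\<^esub> inr (inv\<^bsub>H\<^esub> b)) \<otimes>\<^bsub>X\<^esub> (inl (inv\<^bsub>G\<^esub> a) \<otimes>\<^bsub>X\<^esub> inr p)"
    using ac bc pc tc by (simp add: s X.inv_mult_group X.m_assoc)
  show ?case
    using b
  proof
    \<comment> \<open>A trivial b occurs only in the last syllable, and then the first factor is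
      1.\<close>
    assume "b = \<one>\<^bsub>H\<^esub> \<and> l = []"
    then show ?thesis using eq ap cone_closed[OF ap] by (simp del: inl.hom_inv)
  next
    assume "(b, \<one>\<^bsub>H\<^esub>) \<in> RH"
    then have "inv\<^bsub>H\<^esub> b \<in> H.P" using H.less_one_iff[OF bc] by simp
    then show ?thesis using eq ap Cons.IH[OF l] cone_mult by metis
  qed
qed


lemma cone_total:
  assumes "x \<in> carrier X"
  shows "x \<in> cone \<or> x = \<one>\<^bsub>X\<^esub> \<or> inv\<^bsub>X\<^esub> x \<in> cone"
proof -
  obtain \<nu> where \<nu>: "\<nu> \<in> H_forms" "x = form_value \<nu>"
    using normal_form_exists[OF assms] .
  obtain h l where "\<nu> = (h, l)" by (cases \<nu>)
  with \<nu> have x: "(h, l) \<in> H_forms" "x = form_value (h, l)" by simp_all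
  then have h: "h \<in> carrier H" and l: "syllables l" by (auto simp: H_forms_def)
  consider "(h, l) = (\<one>\<^bsub>H\<^esub>, [])" | "h = \<one>\<^bsub>H\<^esub> \<or> h \<in> H.P" "(h, l) \<noteq> (\<one>\<^bsub>H\<^esub>, [])" | "inv\<^bsub>H\<^esub> h \<in> H.P"
    using H.cone_cases[OF h] by auto
  then show ?thesis
  proof cases
    case 1
    then show ?thesis using x by simp
  next
    case 2
    then show ?thesis using form_value_cone[OF l] x by simp
  next
    case 3
    have "inv\<^bsub>X\<^esub> x = inv\<^bsub>X\<^esub> (tail_value l) \<otimes>\<^bsub>X\<^esub> inr (inv\<^bsub>H\<^esub> h)"
      using x h tail_value_closed[OF l] by (simp add: X.inv_mult_group)
    then show ?thesis using inv_tail_value_cone[OF l 3] by simp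
  qed
qed

section \<open>The identity lies outside the cone\<close>

definition nonneg_forms :: "('b \<times> ('a \<times> 'b) list) set" where
  "nonneg_forms = {(h, l) \<in> H_forms. h = \<one>\<^bsub>H\<^esub> \<or> h \<in> H.P}"

text \<open>With h = z^n b and b <= 1, the bound z^-1 < h gives z^-1 < z^n, so n >= 0. The leading
  letter is z^n or z^n a with a > 1. The weak bound z^-1 < h is what \<open>act_twist_pos\<close>
  can supply.\<close>

lemma fst_to_G_nonneg:
  assumes hl: "(h, l) \<in> H_forms" and h: "(inv\<^bsub>H\<^esub> zH, h) \<in> RH" and g: "to_G (h, l) = (g, \<mu>)"
  shows "g = \<one>\<^bsub>G\<^esub> \<or> g \<in> G.P"
proof -
  have hc: "h \<in> carrier H" "syllables l" using hl by (auto simp: H_forms_def)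
  obtain n b where nb: "b = \<one>\<^bsub>H\<^esub> \<or> (inv\<^bsub>H\<^esub> zH, b) \<in> RH \<and> (b, \<one>\<^bsub>H\<^esub>) \<in> RH"
      "h = zH [^]\<^bsub>H\<^esub> (n::int) \<otimes>\<^bsub>H\<^esub> b" "split_H h = (n, b)"
    using split_HE[OF hc(1)] by blast
  have bc: "b \<in> carrier H" using nb(1) H.less_closed by auto
  have "zH [^]\<^bsub>H\<^esub> (-1::int) = inv\<^bsub>H\<^esub> zH" by (simp add: H.int_pow_neg)
  then have "(zH [^]\<^bsub>H\<^esub> (-1::int), zH [^]\<^bsub>H\<^esub> n \<otimes>\<^bsub>H\<^esub> b) \<in> RH" using h nb(2) by simp
  moreover have "zH [^]\<^bsub>H\<^esub> n \<otimes>\<^bsub>H\<^esub> b = zH [^]\<^bsub>H\<^esub> n \<or> (zH [^]\<^bsub>H\<^esub> n \<otimes>\<^bsub>H\<^esub> b, zH [^]\<^bsub>H\<^esub> n) \<in> RH"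
    using nb(1) H.less_mult_left[of "zH [^]\<^bsub>H\<^esub> n" b "\<one>\<^bsub>H\<^esub>"] by auto
  ultimately have "(zH [^]\<^bsub>H\<^esub> (-1::int), zH [^]\<^bsub>H\<^esub> n) \<in> RH" using H.less_trans by metis
  then have n: "0 \<le> n" using H.int_pow_less_iff[OF z_pos(2)] by simp
  have zn: "zG [^]\<^bsub>G\<^esub> n = \<one>\<^bsub>G\<^esub> \<or> zG [^]\<^bsub>G\<^esub> n \<in> G.P"
    using n G.int_pow_cone[OF z_pos(1), of n] by (cases "n = 0") auto
  show ?thesis
  proof (cases l)
    case Nil
    then show ?thesis using g nb(3) zn by simp
  next
    case (Cons s l')
    obtain a b' where s: "s = (a, b')" by (cases s)
    then have a: "a \<in> G.P" using hc(2) Cons by (auto simp: G.cone_iff)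
    then have "zG [^]\<^bsub>G\<^esub> n \<otimes>\<^bsub>G\<^esub> a \<in> G.P" using zn G.cone_mult G.cone_closed by auto
    then show ?thesis using g nb(3) zn by (auto simp: Cons s split: if_splits)
  qed
qed

text \<open>From 1 < g = z^n a and a < z follows 1 < z^(n+1), so n >= 0. A nontrivial a stays as a
  syllable behind the head z^n. If a = 1, then n >= 1, and the head z^n b = z^(n-1) (zb) is
  positive. Neither case yields the trivial form.\<close>

lemma to_H_pos:
  assumes gbl: "(g, b, l) \<in> G_forms" and g: "g \<in> G.P"
  shows "to_H (g, b, l) \<in> nonneg_forms - {(\<one>\<^bsub>H\<^esub>, [])}"
proof -
  have gc: "g \<in> carrier G" using g by (rule G.cone_closed)
  have b: "b = \<one>\<^bsub>H\<^esub> \<or> (inv\<^bsub>H\<^esub> zH, b) \<in> RH" using gbl by (auto simp: G_forms_def)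
  have bc: "b \<in> carrier H" using b H.less_closed by auto
  obtain n a where na: "a = \<one>\<^bsub>G\<^esub> \<or> (\<one>\<^bsub>G\<^esub>, a) \<in> RG \<and> (a, zG) \<in> RG"
      "g = zG [^]\<^bsub>G\<^esub> (n::int) \<otimes>\<^bsub>G\<^esub> a" "split_G g = (n, a)"
    using split_GE[OF gc] by blast
  have "(a, zG) \<in> RG" using na(1) z_pos(1) by (auto simp: G.cone_iff)
  then have "(g, zG [^]\<^bsub>G\<^esub> (n + 1)) \<in> RG"
    using G.less_mult_left[of "zG [^]\<^bsub>G\<^esub> n" a zG] na(2) by (simp add: G.int_pow_mult)
  moreover have "(zG [^]\<^bsub>G\<^esub> (0::int), g) \<in> RG" using g by (simp add: G.cone_iff)
  ultimately have "(zG [^]\<^bsub>G\<^esub> (0::int), zG [^]\<^bsub>G\<^esub> (n + 1)) \<in> RG" using G.less_trans by blast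
  then have n: "0 \<le> n" using G.int_pow_less_iff[OF z_pos(1)] by (simp del: int_pow_0)
  have form: "to_H (g, b, l) \<in> H_forms" using to_H(1)[OF gbl] .
  show ?thesis
  proof (cases "a = \<one>\<^bsub>G\<^esub>")
    case True
    have "n \<noteq> 0" using True na(2) g G.one_notin_cone by auto
    then have "1 \<le> n" using n by simp
    have "zH \<otimes>\<^bsub>H\<^esub> b \<in> H.P"
      using b H.less_iff_cone[of "inv\<^bsub>H\<^esub> zH" b] bc z_pos by auto
    moreover have "zH [^]\<^bsub>H\<^esub> (n - 1) = \<one>\<^bsub>H\<^esub> \<or> zH [^]\<^bsub>H\<^esub> (n - 1) \<in> H.P"
      using \<open>1 \<le> n\<close> H.int_pow_cone[OF z_pos(2), of "n - 1"] by (cases "n = 1") auto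
    ultimately have "zH [^]\<^bsub>H\<^esub> (n - 1) \<otimes>\<^bsub>H\<^esub> (zH \<otimes>\<^bsub>H\<^esub> b) \<in> H.P"
      using H.cone_mult H.cone_closed by auto
    moreover have "zH [^]\<^bsub>H\<^esub> (n - 1) \<otimes>\<^bsub>H\<^esub> (zH \<otimes>\<^bsub>H\<^esub> b) = zH [^]\<^bsub>H\<^esub> n \<otimes>\<^bsub>H\<^esub> b"
      using H.int_pow_mult[of zH "n - 1" 1] bc by (simp add: H.m_assoc[symmetric])
    ultimately have "zH [^]\<^bsub>H\<^esub> n \<otimes>\<^bsub>H\<^esub> b \<in> H.P" by simp
    then show ?thesis
      using form True na(3) H.one_notin_cone by (auto simp: nonneg_forms_def)
  next
    case False
    have "zH [^]\<^bsub>H\<^esub> n = \<one>\<^bsub>H\<^esub> \<or> zH [^]\<^bsub>H\<^esub> n \<in> H.P"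
      using n H.int_pow_cone[OF z_pos(2), of n] by (cases "n = 0") auto
    then show ?thesis using form False na(3) by (auto simp: nonneg_forms_def)
  qed
qed

text \<open>The factor z^-1 h_1 takes a head h >= 1 to z^-1 h_1 h > z^-1, which suffices for a
  leading \<open>G\<close> letter >= 1; multiplication by g makes this letter positive.\<close>

lemma act_twist_pos:
  assumes g: "g \<in> G.P" and \<nu>: "\<nu> \<in> nonneg_forms"
  shows "act (twist g) \<nu> \<in> nonneg_forms - {(\<one>\<^bsub>H\<^esub>, [])}"
proof -
  obtain h l where hl: "\<nu> = (h, l)" "h \<in> carrier H" "syllables l" "h = \<one>\<^bsub>H\<^esub> \<or> h \<in> H.P"
    using \<nu> by (auto simp: nonneg_forms_def H_forms_def)
  have gc: "g \<in> carrier G" using g by (rule G.cone_closed)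
  define h' where "h' = inv\<^bsub>H\<^esub> zH \<otimes>\<^bsub>H\<^esub> (h1 \<otimes>\<^bsub>H\<^esub> h)"
  have "h1 \<otimes>\<^bsub>H\<^esub> h \<in> H.P" using hl(2,4) h1(1) H.cone_mult by auto
  then have h': "(inv\<^bsub>H\<^esub> zH, h') \<in> RH" unfolding h'_def by (intro H.less_mult_cone) simp_all
  have h'l: "(h', l) \<in> H_forms" using hl by (simp add: H_forms_def h'_def)
  have tw: "twist g = inl g \<otimes>\<^bsub>X\<^esub> inr (inv\<^bsub>H\<^esub> zH \<otimes>\<^bsub>H\<^esub> h1)"
    using gc by (simp add: twist_def X.m_assoc)
  have \<nu>f: "\<nu> \<in> H_forms" using \<nu> by (auto simp: nonneg_forms_def)
  have "act (inr (inv\<^bsub>H\<^esub> zH \<otimes>\<^bsub>H\<^esub> h1)) \<nu> = (h', l)"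
    using act_inr[OF _ \<nu>f, of "inv\<^bsub>H\<^esub> zH \<otimes>\<^bsub>H\<^esub> h1"] hl by (simp add: h'_def H.m_assoc)
  then have eq: "act (twist g) \<nu> = act_G g (h', l)"
    unfolding tw using gc \<nu>f h'l act_inl by (subst act_mult) (auto simp del: act_G.simps)
  obtain g' b' l' where g': "to_G (h', l) = (g', b', l')" by (cases "to_G (h', l)")
  then have f: "(g', b', l') \<in> G_forms" using to_G(1)[OF h'l] by simp
  have "g \<otimes>\<^bsub>G\<^esub> g' \<in> G.P"
    using fst_to_G_nonneg[OF h'l h' g'] g gc G.cone_mult by auto
  then have "to_H (g \<otimes>\<^bsub>G\<^esub> g', b', l') \<in> nonneg_forms - {(\<one>\<^bsub>H\<^esub>, [])}"
    using to_H_pos[OF G_forms_mult[OF gc f]] by blast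
  then show ?thesis using eq g' by (simp del: to_H.simps to_G.simps)
qed

text \<open>A ping-pong argument: each generator maps the forms with head >= 1 into themselves and
  misses the trivial form, hence so does each product.\<close>

lemma act_cone_pos:
  assumes "x \<in> cone" "\<nu> \<in> nonneg_forms"
  shows "act x \<nu> \<in> nonneg_forms - {(\<one>\<^bsub>H\<^esub>, [])}"
  using assms unfolding cone_def
proof (induction arbitrary: \<nu>)
  case (gen_incl s)
  then consider g where "g \<in> G.P" "s = twist g" | p where "p \<in> H.P" "s = inr p" by blast
  then show ?case
  proof cases
    case 1
    then show ?thesis using act_twist_pos gen_incl(2) by simp
  next
    case 2
    obtain h l where hl: "\<nu> = (h, l)" "h = \<one>\<^bsub>H\<^esub> \<or> h \<in> H.P" "\<nu> \<in> H_forms"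
      using gen_incl(2) by (auto simp: nonneg_forms_def)
    have "p \<otimes>\<^bsub>H\<^esub> h \<in> H.P" using 2 hl(2) H.cone_mult H.cone_closed by auto
    moreover have "act (inr p) \<nu> = (p \<otimes>\<^bsub>H\<^esub> h, l)"
      using act_inr[OF H.cone_closed[OF 2(1)] hl(3)] hl(1) by simp
    moreover have "(p \<otimes>\<^bsub>H\<^esub> h, l) \<in> H_forms"
      using act_H_closed[OF H.cone_closed[OF 2(1)] hl(3)] hl(1) by simp
    ultimately show ?thesis using 2(2) H.one_notin_cone by (auto simp: nonneg_forms_def)
  qed
next
  case (gen_mult a b)
  then have cl: "a \<in> carrier X" "b \<in> carrier X" using cone_closed cone_def by auto
  have "\<nu> \<in> H_forms" using gen_mult.prems by (auto simp: nonneg_forms_def)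
  then have "act (a \<otimes>\<^bsub>X\<^esub> b) \<nu> = act a (act b \<nu>)" using cl act_mult by simp
  then show ?case using gen_mult by simp
qed

lemma one_notin_cone: "\<one>\<^bsub>X\<^esub> \<notin> cone"
proof
  assume "\<one>\<^bsub>X\<^esub> \<in> cone"
  moreover have "(\<one>\<^bsub>H\<^esub>, []) \<in> nonneg_forms" by (simp add: nonneg_forms_def H_forms_def)
  ultimately show False using act_cone_pos act_one by (force simp: nonneg_forms_def)
qed

section \<open>The ordering of the amalgam and the comparison of its generators\<close>

definition RX :: "('a + 'b) list set rel" where
  "RX = cone_ordering X cone"

sublocale RX: left_ordered_group X RX
  unfolding left_ordered_group_def left_ordered_group_axioms_def RX_def
  using X.cone_ordering(1)[of cone] cone_closed cone_mult one_notin_cone cone_total X.is_group by blast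

lemma positive_cone_RX: "RX.P = cone"
  unfolding RX_def
  using X.cone_ordering(2)[of cone] cone_closed cone_mult one_notin_cone cone_total by blast

lemma RX_iff: "a \<in> carrier X \<Longrightarrow> b \<in> carrier X \<Longrightarrow> (a, b) \<in> RX \<longleftrightarrow> inv\<^bsub>X\<^esub> a \<otimes>\<^bsub>X\<^esub> b \<in> cone"
  by (simp add: RX.less_iff_cone positive_cone_RX)

lemma inl_mono: "(a, b) \<in> RG \<Longrightarrow> (inl a, inl b) \<in> RX"
  using G.less_closed[of a b] G.less_iff_cone[of a b] inl_cone[of "inv\<^bsub>G\<^esub> a \<otimes>\<^bsub>G\<^esub> b"] by (simp add: RX_iff)

lemma inr_mono: "(a, b) \<in> RH \<Longrightarrow> (inr a, inr b) \<in> RX"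
  using H.less_closed[of a b] H.less_iff_cone[of a b] inr_cone[of "inv\<^bsub>H\<^esub> a \<otimes>\<^bsub>H\<^esub> b"] by (simp add: RX_iff)

lemma inv_twist_mult:
  assumes "a \<in> carrier G" "b \<in> carrier G"
  shows "inv\<^bsub>X\<^esub> (twist a) \<otimes>\<^bsub>X\<^esub> twist b = inr (inv\<^bsub>H\<^esub> h1 \<otimes>\<^bsub>H\<^esub> zH) \<otimes>\<^bsub>X\<^esub> twist (inv\<^bsub>G\<^esub> a \<otimes>\<^bsub>G\<^esub> b)"
  using twist_mult[of a "inv\<^bsub>G\<^esub> a \<otimes>\<^bsub>G\<^esub> b"] assms
  by (simp add: G.m_assoc[symmetric] del: inr.hom_mult)

lemma twist_mono:
  assumes "(a, b) \<in> RG"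
  shows "(twist a, twist b) \<in> RX"
proof -
  have cl: "a \<in> carrier G" "b \<in> carrier G" using assms G.less_closed by auto
  have "inv\<^bsub>G\<^esub> a \<otimes>\<^bsub>G\<^esub> b \<in> G.P" using assms G.less_iff_cone[OF cl] by simp
  then show ?thesis
    using cl inv_twist_mult[OF cl] cone_mult[OF inr_cone[OF gap_cone] twist_cone] by (simp add: RX_iff)
qed

lemma z_comm_h1: "zH \<otimes>\<^bsub>H\<^esub> h1 = h1 \<otimes>\<^bsub>H\<^esub> zH"
  using H.least_commutes[OF right_invariant_zH _ h1(1,2)] by simp

lemma z_comm_inl: "g \<in> carrier G \<Longrightarrow> z \<otimes>\<^bsub>X\<^esub> inl g = inl g \<otimes>\<^bsub>X\<^esub> z"
  using central[of g] unfolding z_def by (metis closed(1) inl.hom_mult)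

text \<open>The element h_1 is itself the twist of \<open>zG\<close>, since z z^-1 cancels, so this
  is an instance of \<open>twist_mono\<close>.\<close>

lemma twist_less_h1:
  assumes "(g, zG) \<in> RG"
  shows "(twist g, inr h1) \<in> RX"
proof -
  have g: "g \<in> carrier G" using assms G.less_closed by auto
  have "inr h1 = twist zG"
    using z_eq by (simp add: twist_def z_def)
  then show ?thesis using twist_mono[OF assms] by simp
qed

text \<open>It suffices to compare with generators: the x_g are ordered as in \<open>G\<close>, and
  positive elements of \<open>H\<close> are at least h_1, which exceeds x_(g_1) because g_1 <
  z.\<close>

lemma twist_g1_least:
  assumes "x \<in> cone"
  shows "x = twist g1 \<or> (twist g1, x) \<in> RX"
proof (rule RX.semigroup_cone_least[where S = "twist ` G.P \<union> inr ` H.P"])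
  show "RX.P = semigroup_generated X (twist ` G.P \<union> inr ` H.P)"
    by (simp add: positive_cone_RX cone_def)
  show "twist g1 \<in> twist ` G.P \<union> inr ` H.P" using g1(1) by simp
  show "t = twist g1 \<or> (twist g1, t) \<in> RX" if t: "t \<in> twist ` G.P \<union> inr ` H.P" for t
    using t
  proof
    assume "t \<in> twist ` G.P"
    then show ?thesis using g1(2) twist_mono by blast
  next
    assume "t \<in> inr ` H.P"
    then obtain h where h: "h \<in> H.P" "t = inr h" by blast
    then have "t = inr h1 \<or> (inr h1, t) \<in> RX" using h1(2) inr_mono by blast
    then show ?thesis using twist_less_h1[OF g1(3)] RX.less_trans by blast
  qed
qed (use assms in \<open>simp add: positive_cone_RX\<close>)

text \<open>Amounts to stability of the cone under conjugation by \<open>z\<close>. Each x_g is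
  fixed, as \<open>z\<close> commutes with \<open>G\<close> and with h_1, the least positive element
  of \<open>H\<close>; positive elements of \<open>H\<close> stay positive by right invariance in
  \<open>H\<close>.\<close>

lemma right_invariant_z: "right_invariant X RX z"
proof -
  have conj: "inv\<^bsub>X\<^esub> z \<otimes>\<^bsub>X\<^esub> x \<otimes>\<^bsub>X\<^esub> z \<in> cone" if "x \<in> cone" for x
    using that[unfolded cone_def]
  proof induction
    case (gen_incl s)
    then consider g where "g \<in> G.P" "s = twist g" | p where "p \<in> H.P" "s = inr p" by blast
    then show ?case
    proof cases
      case 1
      have g: "g \<in> carrier G" using 1(1) by (rule G.cone_closed)
      have "twist g \<otimes>\<^bsub>X\<^esub> z = z \<otimes>\<^bsub>X\<^esub> twist g"
      proof -
        have "inr h1 \<otimes>\<^bsub>X\<^esub> z = z \<otimes>\<^bsub>X\<^esub> inr h1"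
          unfolding z_eq using z_comm_h1 by (metis closed(2,4) inr.hom_mult)
        then have "twist g \<otimes>\<^bsub>X\<^esub> z = inl g \<otimes>\<^bsub>X\<^esub> (inv\<^bsub>X\<^esub> z \<otimes>\<^bsub>X\<^esub> (z \<otimes>\<^bsub>X\<^esub> inr h1))"
          using g by (simp add: twist_def z_eq[symmetric] X.m_assoc)
        also have "\<dots> = inl g \<otimes>\<^bsub>X\<^esub> z \<otimes>\<^bsub>X\<^esub> (inv\<^bsub>X\<^esub> z \<otimes>\<^bsub>X\<^esub> inr h1)"
          using g by (simp add: X.m_assoc)
        also have "\<dots> = z \<otimes>\<^bsub>X\<^esub> inl g \<otimes>\<^bsub>X\<^esub> (inv\<^bsub>X\<^esub> z \<otimes>\<^bsub>X\<^esub> inr h1)"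
          using z_comm_inl[OF g] by simp
        also have "\<dots> = z \<otimes>\<^bsub>X\<^esub> twist g"
          using g by (simp add: twist_def z_eq[symmetric] X.m_assoc)
        finally show ?thesis .
      qed
      then have "inv\<^bsub>X\<^esub> z \<otimes>\<^bsub>X\<^esub> s \<otimes>\<^bsub>X\<^esub> z = s"
        using g 1(2) by (simp add: X.m_assoc)
      then show ?thesis using 1 twist_cone by simp
    next
      case 2
      have "inv\<^bsub>X\<^esub> z \<otimes>\<^bsub>X\<^esub> s \<otimes>\<^bsub>X\<^esub> z = inr (inv\<^bsub>H\<^esub> zH \<otimes>\<^bsub>H\<^esub> p \<otimes>\<^bsub>H\<^esub> zH)"
        using 2 H.cone_closed by (simp add: z_eq)
      then show ?thesis
        using inr_cone H.right_invariant_conj(1)[OF right_invariant_zH _ 2(1)] by simp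
    qed
  next
    case (gen_mult a b)
    then have cl: "a \<in> carrier X" "b \<in> carrier X" using cone_closed cone_def by auto
    have "inv\<^bsub>X\<^esub> z \<otimes>\<^bsub>X\<^esub> (a \<otimes>\<^bsub>X\<^esub> b) \<otimes>\<^bsub>X\<^esub> z = (inv\<^bsub>X\<^esub> z \<otimes>\<^bsub>X\<^esub> a \<otimes>\<^bsub>X\<^esub> z) \<otimes>\<^bsub>X\<^esub> (inv\<^bsub>X\<^esub> z \<otimes>\<^bsub>X\<^esub> b \<otimes>\<^bsub>X\<^esub> z)"
      using cl by (simp add: X.m_assoc)
    then show ?case using gen_mult.IH cone_mult by simp
  qed
  have "(a \<otimes>\<^bsub>X\<^esub> z, b \<otimes>\<^bsub>X\<^esub> z) \<in> RX" if ab: "(a, b) \<in> RX" for a b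
  proof -
    have cl: "a \<in> carrier X" "b \<in> carrier X" using ab RX.less_closed by auto
    have "inv\<^bsub>X\<^esub> (a \<otimes>\<^bsub>X\<^esub> z) \<otimes>\<^bsub>X\<^esub> (b \<otimes>\<^bsub>X\<^esub> z) = inv\<^bsub>X\<^esub> z \<otimes>\<^bsub>X\<^esub> (inv\<^bsub>X\<^esub> a \<otimes>\<^bsub>X\<^esub> b) \<otimes>\<^bsub>X\<^esub> z"
      using cl by (simp add: X.inv_mult_group X.m_assoc)
    then show ?thesis using conj ab cl by (simp add: RX_iff)
  qed
  then show ?thesis by (auto simp: right_invariant_def)
qed

section \<open>Cofinality of \<open>z\<close> and convex subgroups\<close>

lemma z_cone: "z \<in> cone"
  using inl_cone[OF z_pos(1)] by (simp add: z_def)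

lemma inr_less_z: "(h, zH) \<in> RH \<Longrightarrow> (inr h, z) \<in> RX"
  using inr_mono z_eq by simp

lemma cofinal_z:
  assumes "G.P = semigroup_generated G S" "H.P = semigroup_generated H T"
    and "\<And>s. s \<in> S \<Longrightarrow> (s, zG) \<in> RG" "\<And>t. t \<in> T \<Longrightarrow> (t, zH) \<in> RH"
  shows "cofinal_elt X RX z"
proof (rule RX.cofinal_of_generators[OF right_invariant_z])
  show "RX.P = semigroup_generated X (twist ` S \<union> inr ` T)"
    using cone_eq_generated[OF assms(1,2)] by (simp add: positive_cone_RX)
  show "(x, z) \<in> RX" if "x \<in> twist ` S \<union> inr ` T" for x
    using that assms(3,4) twist_less_h1 inr_less_z[OF h1(3)] inr_less_z RX.less_trans by blast
qed (simp add: positive_cone_RX z_cone)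

text \<open>\<open>Y\<close> contains the least positive element x_1 but not h_1, as otherwise it
  would contain all powers of \<open>z\<close>. A positive element of \<open>Y\<close> is a product
  of cone generators that all lie in \<open>Y\<close>, and any of them other than x_1 would force
  h_1 into \<open>Y\<close>.\<close>

lemma convex_subgroup:
  assumes cofinal: "cofinal_elt X RX z"
    and Y: "subgroup Y X" "Y \<noteq> {\<one>\<^bsub>X\<^esub>}" "Y \<noteq> carrier X" "order_convex X RX Y"
  shows "Y = generate X {twist g1}" "infinite Y"
proof -
  interpret Y: subgroup Y X by (rule Y(1))
  have down: "p \<in> Y" if "y \<in> Y" "p \<in> cone" "y = p \<or> (p, y) \<in> RX" for p y
    using that(3)
  proof
    assume "(p, y) \<in> RX"
    moreover have "(\<one>\<^bsub>X\<^esub>, p) \<in> RX" using that(2) RX.cone_iff positive_cone_RX by blast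
    ultimately show ?thesis
      using Y(4) that(1) Y.one_closed cone_closed[OF that(2)] unfolding order_convex_def by blast
  qed (use that in simp)
  have down_mult: "p \<in> Y \<and> q \<in> Y" if "p \<otimes>\<^bsub>X\<^esub> q \<in> Y" "p \<in> cone" "q \<in> cone" for p q
  proof -
    have "p \<in> Y"
      using down[OF that(1,2)] RX.less_mult_cone[of p q] that cone_closed by (simp add: positive_cone_RX)
    moreover have "q = inv\<^bsub>X\<^esub> p \<otimes>\<^bsub>X\<^esub> (p \<otimes>\<^bsub>X\<^esub> q)"
      using that cone_closed by (simp add:)
    ultimately show ?thesis using that(1) Y.m_closed Y.m_inv_closed by metis
  qed
  obtain y where y: "y \<in> Y" "y \<noteq> \<one>\<^bsub>X\<^esub>" using Y(2) Y.one_closed by blast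
  then have "y \<in> cone \<or> inv\<^bsub>X\<^esub> y \<in> cone" using cone_total[of y] Y.mem_carrier by blast
  then obtain y' where "y' \<in> Y" "y' \<in> cone" using y Y.m_inv_closed by blast
  then have x1: "twist g1 \<in> Y" using down[of y' "twist g1"] twist_g1_least[of y'] twist_cone[OF g1(1)] by blast
  have gen: "generate X {twist g1} \<subseteq> Y" using x1 Y(1) X.generate_subgroup_incl by blast
  show "infinite Y"
  proof -
    have "inj (\<lambda>n::int. twist g1 [^]\<^bsub>X\<^esub> n)"
    proof (rule injI)
      fix m n :: int assume "twist g1 [^]\<^bsub>X\<^esub> m = twist g1 [^]\<^bsub>X\<^esub> n"
      then show "m = n"
        using RX.int_pow_less_iff[of "twist g1" m n] RX.int_pow_less_iff[of "twist g1" n m]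
          RX.less_irrefl twist_cone[OF g1(1)] positive_cone_RX by (metis linorder_neqE)
    qed
    moreover have "range (\<lambda>n::int. twist g1 [^]\<^bsub>X\<^esub> n) \<subseteq> Y"
      using x1 Y(1) X.subgroup_int_pow_closed by blast
    ultimately show ?thesis
      using finite_subset finite_imageD[of _ UNIV] infinite_UNIV_int by metis
  qed
  have no_h1: "inr h1 \<notin> Y"
  proof
    assume h1Y: "inr h1 \<in> Y"
    \<comment> \<open>The choice makes q = h_1 x_1^-1, an element of \<open>Y\<close>. As g_1 <= q,
      also g_1 lies in \<open>Y\<close>, and so does z = g_1 q.\<close>
    define q where "q = zG \<otimes>\<^bsub>G\<^esub> inv\<^bsub>G\<^esub> g1"
    have q: "q = inv\<^bsub>G\<^esub> g1 \<otimes>\<^bsub>G\<^esub> zG" unfolding q_def by (rule central) simp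
    then have qP: "q \<in> G.P" using g1(3) G.less_iff_cone[of g1 zG] by simp
    have qc: "q \<in> carrier G" by (simp add: q_def)
    have "inl q = inr h1 \<otimes>\<^bsub>X\<^esub> inv\<^bsub>X\<^esub> (twist g1)"
      using z_eq by (simp add: q_def twist_def X.inv_mult_group X.m_assoc[symmetric] z_def)
    then have qY: "inl q \<in> Y" using h1Y x1 Y.m_closed Y.m_inv_closed by simp
    have "inl q = inl g1 \<or> (inl g1, inl q) \<in> RX" using g1(2)[OF qP] inl_mono by blast
    then have "inl g1 \<in> Y" using down[OF qY inl_cone[OF g1(1)]] by blast
    moreover have "z = inl g1 \<otimes>\<^bsub>X\<^esub> inl q"
      using q inl.hom_mult[of g1 q] qc by (simp add: z_def )
    ultimately have "z \<in> Y" using qY Y.m_closed by simp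
    then have zY: "z [^]\<^bsub>X\<^esub> (n::int) \<in> Y" for n using X.subgroup_int_pow_closed[OF Y(1)] by blast
    have "x \<in> Y" if "x \<in> carrier X" for x
      using that cofinal Y(4) zY unfolding order_convex_def cofinal_elt_def by metis
    then show False using Y(3) Y.subset by blast
  qed
  have in_gen: "x \<in> generate X {twist g1}" if "x \<in> cone" "x \<in> Y" for x
    using that[unfolded cone_def]
  proof induction
    case (gen_incl s)
    then consider g where "g \<in> G.P" "s = twist g" | p where "p \<in> H.P" "s = inr p" by blast
    then show ?case
    proof cases
      case 1
      show ?thesis
      proof (cases "g = g1")
        case False
        have gc: "g \<in> carrier G" using 1(1) by (rule G.cone_closed)
        have "(g1, g) \<in> RG" using False 1(1) g1(2) by blast
        then have p: "inv\<^bsub>G\<^esub> g1 \<otimes>\<^bsub>G\<^esub> g \<in> G.P" using gc G.less_iff_cone[of g1 g] by simp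
        \<comment> \<open>This product is x_1^-1 x_g. Its first factor h_1^-1 z then lies in
          \<open>Y\<close> as well, and being at least h_1 it would bring h_1 into
          \<open>Y\<close>.\<close>
        have "inr (inv\<^bsub>H\<^esub> h1 \<otimes>\<^bsub>H\<^esub> zH) \<otimes>\<^bsub>X\<^esub> twist (inv\<^bsub>G\<^esub> g1 \<otimes>\<^bsub>G\<^esub> g) \<in> Y"
          using inv_twist_mult[of g1 g] gc 1(2) gen_incl(2) x1 Y.m_closed Y.m_inv_closed by (metis closed(3))
        then have "inr (inv\<^bsub>H\<^esub> h1 \<otimes>\<^bsub>H\<^esub> zH) \<in> Y"
          using down_mult inr_cone[OF gap_cone] twist_cone[OF p] by blast
        moreover have "inr (inv\<^bsub>H\<^esub> h1 \<otimes>\<^bsub>H\<^esub> zH) = inr h1 \<or> (inr h1, inr (inv\<^bsub>H\<^esub> h1 \<otimes>\<^bsub>H\<^esub> zH)) \<in> RX"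
          using h1(2)[OF gap_cone] inr_mono by metis
        ultimately have "inr h1 \<in> Y" using down inr_cone[OF h1(1)] by blast
        then show ?thesis using no_h1 by simp
      qed (use 1 in \<open>auto intro: generate.incl\<close>)
    next
      case 2
      then have "s = inr h1 \<or> (inr h1, s) \<in> RX" using h1(2) inr_mono by blast
      then show ?thesis using no_h1 down[OF gen_incl(2) inr_cone[OF h1(1)]] by blast
    qed
  next
    case (gen_mult a b)
    then show ?case using down_mult[of a b] generate.eng unfolding cone_def by metis
  qed
  have "Y \<subseteq> generate X {twist g1}"
  proof
    fix x assume x: "x \<in> Y"
    then have xc: "x \<in> carrier X" by (rule Y.mem_carrier)
    have gs: "subgroup (generate X {twist g1}) X"
      by (rule X.generate_is_subgroup) simp
    consider "x \<in> cone" | "x = \<one>\<^bsub>X\<^esub>" | "inv\<^bsub>X\<^esub> x \<in> cone" using cone_total[OF xc] by blast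
    then show "x \<in> generate X {twist g1}"
    proof cases
      case 3
      then have "inv\<^bsub>X\<^esub> x \<in> generate X {twist g1}" using in_gen x Y.m_inv_closed by blast
      then show ?thesis using subgroup.m_inv_closed[OF gs] xc by force
    qed (use in_gen x generate.one in auto)
  qed
  then show "Y = generate X {twist g1}" using gen by blast
qed


section \<open>Generation and rank\<close>

lemma cone_generate:
  assumes "cone = semigroup_generated X S"
  shows "generate X S = carrier X"
proof
  have S: "S \<subseteq> carrier X"
    using cone_closed unfolding assms by (auto intro: semigroup_generated.gen_incl)
  then show "generate X S \<subseteq> carrier X" by (rule X.generate_incl)
  have sub: "cone \<subseteq> generate X S"
    unfolding assms by (intro semigroup_generated_least) (auto intro: generate.incl generate.eng)
  show "carrier X \<subseteq> generate X S"
  proof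
    fix x assume x: "x \<in> carrier X"
    consider "x \<in> cone" | "x = \<one>\<^bsub>X\<^esub>" | "inv\<^bsub>X\<^esub> x \<in> cone" using cone_total[OF x] by blast
    then show "x \<in> generate X S"
    proof cases
      case 3
      then have "inv\<^bsub>X\<^esub> (inv\<^bsub>X\<^esub> x) \<in> generate X S"
        using sub subgroup.m_inv_closed[OF X.generate_is_subgroup[OF S]] by blast
      then show ?thesis using x by simp
    qed (use sub generate.one in auto)
  qed
qed

lemma defines_RX:
  assumes "finite S" "finite T" "G.P = semigroup_generated G S" "H.P = semigroup_generated H T"
  shows "defines_isolated_ordering X (twist ` S \<union> inr ` T) RX"
proof -
  have eq: "cone = semigroup_generated X (twist ` S \<union> inr ` T)"
    using assms(3,4) by (rule cone_eq_generated)
  then have "twist ` S \<union> inr ` T \<subseteq> cone" by (auto intro: semigroup_generated.gen_incl)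
  then have "twist ` S \<union> inr ` T \<subseteq> carrier X - {\<one>\<^bsub>X\<^esub>}" using one_notin_cone cone_closed by blast
  then show ?thesis
    using assms(1,2) eq RX.ordering by (simp add: defines_isolated_ordering_def positive_cone_RX)
qed

text \<open>A minimal generating set of the cone of \<open>G\<close>, twisted, together with one for
  \<open>H\<close> generates the cone of \<open>X\<close>. If one of the two cones has no finite
  generating set, the right side is infinite.\<close>

lemma rank_RX: "ordering_rank X RX \<le> ordering_rank G RG + ordering_rank H RH"
proof -
  let ?gens = "\<lambda>K R. {S. finite S \<and> semigroup_generated K S = positive_cone K R}"
  show ?thesis
  proof (cases "?gens G RG = {} \<or> ?gens H RH = {}")
    case True
    then show ?thesis
    proof
      assume "?gens G RG = {}"
      then have "ordering_rank G RG = \<infinity>"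
        unfolding ordering_rank_def by (simp only: image_empty Inf_empty top_enat_def)
      then show ?thesis by simp
    next
      assume "?gens H RH = {}"
      then have "ordering_rank H RH = \<infinity>"
        unfolding ordering_rank_def by (simp only: image_empty Inf_empty top_enat_def)
      then show ?thesis by simp
    qed
  next
    case False
    have "ordering_rank G RG \<in> (\<lambda>S. enat (card S)) ` ?gens G RG"
      "ordering_rank H RH \<in> (\<lambda>S. enat (card S)) ` ?gens H RH"
      unfolding ordering_rank_def using False by (auto intro!: wellorder_InfI)
    then obtain S T where ST: "finite S" "semigroup_generated G S = G.P" "ordering_rank G RG = enat (card S)"
      "finite T" "semigroup_generated H T = H.P" "ordering_rank H RH = enat (card T)" by blast
    let ?U = "twist ` S \<union> inr ` T"
    have "semigroup_generated X ?U = RX.P"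
      using cone_eq_generated[of S T] ST by (simp add: positive_cone_RX)
    then have "ordering_rank X RX \<le> enat (card ?U)"
      unfolding ordering_rank_def using ST by (intro INF_lower) simp
    also have "card ?U \<le> card S + card T"
      using card_Un_le[of "twist ` S" "inr ` T"] card_image_le[OF ST(1), of twist]
        card_image_le[OF ST(4), of inr] by linarith
    then have "enat (card ?U) \<le> enat (card S) + enat (card T)" by simp
    finally show ?thesis using ST by simp
  qed
qed

end

section \<open>Passage from enumerated generators to the ordered amalgam\<close>

theorem theorem1p1:
  fixes G :: "('a, 'c) monoid_scheme" and H :: "('b, 'd) monoid_scheme"
    and zG :: 'a and zH :: 'b
    and gs :: "'a list" and hs :: "'b list"
    and RG :: "'a rel" and RH :: "'b rel"
    and X :: "(('a + 'b) list set) monoid"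
    and \<iota>G :: "'a \<Rightarrow> ('a + 'b) list set" and \<iota>H :: "'b \<Rightarrow> ('a + 'b) list set"
    and z :: "('a + 'b) list set" and xs :: "('a + 'b) list set list"
  assumes "group G" and "group H"
    and "zG \<in> carrier G" and "zG \<noteq> \<one>\<^bsub>G\<^esub>"
    and "\<forall>g\<in>carrier G. zG \<otimes>\<^bsub>G\<^esub> g = g \<otimes>\<^bsub>G\<^esub> zG"
    and "zH \<in> carrier H" and "zH \<noteq> \<one>\<^bsub>H\<^esub>"
    and "generate G (set gs) = carrier G"
    and "defines_isolated_ordering G (set gs) RG"
    and "sorted_wrt (\<lambda>a b. (a, b) \<in> RG) (\<one>\<^bsub>G\<^esub> # gs)"
    and "generate H (set hs) = carrier H"
    and "defines_isolated_ordering H (set hs) RH"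
    and "sorted_wrt (\<lambda>a b. (a, b) \<in> RH) (\<one>\<^bsub>H\<^esub> # hs)"
    and CF_G: "\<forall>g\<in>set gs. (g, zG) \<in> RG"
    and CF_H: "\<forall>h\<in>set hs. (h, zH) \<in> RH"
    and INV_H: "right_invariant H RH zH"
    and "X = cyclic_amalg G zG H zH"
    and "\<iota>G = cyclic_amalg_inl G zG H zH"
    and "\<iota>H = cyclic_amalg_inr G zG H zH"
    and "z = \<iota>G zG"
    and "xs = twisted_gens G zG H zH gs hs"
  shows "\<exists>RX.
    \<comment> \<open>(i)\<close>
      generate X (set xs \<union> \<iota>H ` set hs) = carrier X
    \<and> defines_isolated_ordering X (set xs \<union> \<iota>H ` set hs) RX
    \<and> isolated_ordering X RX
    \<comment> \<open>(ii)\<close>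
    \<and> (\<forall>gs' hs'.
          generate G (set gs') = carrier G
        \<and> defines_isolated_ordering G (set gs') RG
        \<and> sorted_wrt (\<lambda>a b. (a, b) \<in> RG) (\<one>\<^bsub>G\<^esub> # gs')
        \<and> (\<forall>g\<in>set gs'. (g, zG) \<in> RG)
        \<and> generate H (set hs') = carrier H
        \<and> defines_isolated_ordering H (set hs') RH
        \<and> sorted_wrt (\<lambda>a b. (a, b) \<in> RH) (\<one>\<^bsub>H\<^esub> # hs')
        \<and> (\<forall>h\<in>set hs'. (h, zH) \<in> RH)
        \<longrightarrow> defines_isolated_ordering X
              (set (twisted_gens G zG H zH gs' hs') \<union> \<iota>H ` set hs') RX)
    \<comment> \<open>(iii)\<close>
    \<and> \<iota>G \<in> hom G X \<and> (\<forall>a b. (a, b) \<in> RG \<longrightarrow> (\<iota>G a, \<iota>G b) \<in> RX)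
    \<and> \<iota>H \<in> hom H X \<and> (\<forall>a b. (a, b) \<in> RH \<longrightarrow> (\<iota>H a, \<iota>H b) \<in> RX)
    \<comment> \<open>(iv)\<close>
    \<and> z = \<iota>H zH
    \<and> sorted_wrt (\<lambda>a b. (a, b) \<in> RX) (\<one>\<^bsub>X\<^esub> # xs @ map \<iota>H hs @ [z])
    \<and> z \<in> positive_cone X RX
    \<and> cofinal_elt X RX z
    \<and> right_invariant X RX z
    \<comment> \<open>(v)\<close>
    \<and> ordering_rank X RX \<le> ordering_rank G RG + ordering_rank H RH
    \<comment> \<open>(vi)\<close>
    \<and> (\<forall>Y. subgroup Y X \<and> Y \<noteq> {\<one>\<^bsub>X\<^esub>} \<and> Y \<noteq> carrier X \<and> order_convex X RX Y
          \<longrightarrow> Y = generate X {hd xs} \<and> infinite Y)"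
proof -
  interpret G: left_ordered_group G RG
    using assms(1,9) by (auto simp: left_ordered_group_def left_ordered_group_axioms_def defines_isolated_ordering_def)
  interpret H: left_ordered_group H RH
    using assms(2,12) by (auto simp: left_ordered_group_def left_ordered_group_axioms_def defines_isolated_ordering_def)
  have genG: "G.P = semigroup_generated G (set gs)" and genH: "H.P = semigroup_generated H (set hs)"
    using assms(9,12) by (simp_all add: defines_isolated_ordering_def)
  \<comment> \<open>Since \<open>zG\<close> and \<open>zH\<close> are nontrivial, both cones are
    nonempty, so both lists have a head.\<close>
  have "G.P \<noteq> {}" "H.P \<noteq> {}"
    using G.cone_cases[OF assms(3)] H.cone_cases[OF assms(6)] assms(4,7) by auto
  then have "gs \<noteq> []" "hs \<noteq> []" using genG genH by auto
  then obtain g1 gs1 h1 hs1 where gs: "gs = g1 # gs1" and hs: "hs = h1 # hs1"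
    by (metis list.exhaust)
  have g1: "g1 \<in> G.P" "p \<in> G.P \<Longrightarrow> p = g1 \<or> (g1, p) \<in> RG" for p
    using G.semigroup_cone_least[OF genG, of g1 p] assms(10) gs by (auto simp: G.cone_iff)
  have h1: "h1 \<in> H.P" "p \<in> H.P \<Longrightarrow> p = h1 \<or> (h1, p) \<in> RH" for p
    using H.semigroup_cone_least[OF genH, of h1 p] assms(13) hs by (auto simp: H.cone_iff)
  have zP: "zG \<in> G.P" "zH \<in> H.P"
    using g1(1) h1(1) CF_G CF_H gs hs G.less_trans H.less_trans by (auto simp: G.cone_iff H.cone_iff)
  \<comment> \<open>Centrality turns left invariance under \<open>zG\<close> into right
    invariance.\<close>
  have "right_invariant G RG zG"
    unfolding right_invariant_def
  proof clarify
    fix a b assume ab: "(a, b) \<in> RG"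
    then have "(zG \<otimes>\<^bsub>G\<^esub> a, zG \<otimes>\<^bsub>G\<^esub> b) \<in> RG" using assms(3) G.less_mult_left by blast
    then show "(a \<otimes>\<^bsub>G\<^esub> zG, b \<otimes>\<^bsub>G\<^esub> zG) \<in> RG" using assms(5) G.less_closed[OF ab] by simp
  qed
  then have cofG: "cofinal_elt G RG zG"
    using G.cofinal_of_generators[OF _ genG _ zP(1)] CF_G by blast
  have cofH: "cofinal_elt H RH zH"
    using H.cofinal_of_generators[OF INV_H genH _ zP(2)] CF_H by blast
  interpret A: ordered_amalgam G RG H RH zG g1 zH h1
    by unfold_locales (use cofG cofH assms(5) INV_H g1 h1 CF_G CF_H gs hs in auto)
  have X: "A.X = X" "A.inl = \<iota>G" "A.inr = \<iota>H" "A.z = z"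
    using assms(17-20) by (simp_all add: A.z_def cyclic_amalg_def cyclic_amalg_inl_def cyclic_amalg_inr_def)
  \<comment> \<open>Of the second list only the head enters the twisted generators.\<close>
  have twisted: "twisted_gens G zG H zH gs' hs' = map A.twist gs'" if "hd hs' = h1" for gs' hs'
    using that X assms(17-19) by (simp add: twisted_gens_def A.twist_def)
  have xs: "xs = map A.twist gs"
    using twisted[of hs gs] hs assms(21) by simp
  have independent: "defines_isolated_ordering X (set (twisted_gens G zG H zH gs' hs') \<union> \<iota>H ` set hs') A.RX"
    if "defines_isolated_ordering G (set gs') RG" "defines_isolated_ordering H (set hs') RH"
      "sorted_wrt (\<lambda>a b. (a, b) \<in> RH) (\<one>\<^bsub>H\<^esub> # hs')" for gs' hs'
  proof -
    have gen': "G.P = semigroup_generated G (set gs')" "H.P = semigroup_generated H (set hs')"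
      using that by (simp_all add: defines_isolated_ordering_def)
    then have "hs' \<noteq> []"
      using \<open>H.P \<noteq> {}\<close> by auto
    then obtain h' hs1' where hs': "hs' = h' # hs1'" by (cases hs') auto
    \<comment> \<open>The head of any admissible list is the least positive element of
      \<open>H\<close>, hence equals \<open>h1\<close>.\<close>
    have "h' \<in> H.P" "h1 = h' \<or> (h', h1) \<in> RH"
      using H.semigroup_cone_least[OF gen'(2), of h' h1] h1(1) that(3) hs' by (auto simp: H.cone_iff)
    then have "hd hs' = h1"
      using h1(2) hs' H.less_trans H.less_irrefl by (metis list.sel(1))
    then show ?thesis
      using A.defines_RX[OF _ _ gen'] by (simp add: twisted X)
  qed
  have defX: "defines_isolated_ordering X (set xs \<union> \<iota>H ` set hs) A.RX"
    using independent[OF assms(9,12,13)] assms(21) by simp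
  have cone_eq: "A.cone = semigroup_generated X (set xs \<union> \<iota>H ` set hs)"
    using A.cone_eq_generated[OF genG genH] by (simp add: xs X)
  have cofX: "cofinal_elt X A.RX z"
    using A.cofinal_z[OF genG genH] CF_G CF_H by (simp add: X)
  have sorted: "sorted_wrt (\<lambda>a b. (a, b) \<in> A.RX) (\<one>\<^bsub>X\<^esub> # xs @ map \<iota>H hs @ [z])"
  proof -
    let ?less = "\<lambda>a b. (a, b) \<in> A.RX"
    have pos: "(\<one>\<^bsub>X\<^esub>, x) \<in> A.RX" if "x \<in> A.cone" for x
      using that A.RX.cone_iff[of x] A.positive_cone_RX by (simp add: X)
    have sub: "set xs \<union> \<iota>H ` set hs \<subseteq> A.cone"
      unfolding cone_eq by (auto intro: semigroup_generated.gen_incl)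
    have xs_sorted: "sorted_wrt ?less xs"
      unfolding xs sorted_wrt_map
      by (rule sorted_wrt_mono_rel[of _ "\<lambda>a b. (a, b) \<in> RG"]) (use A.twist_mono assms(10) in auto)
    have hs_sorted: "sorted_wrt ?less (map \<iota>H hs)"
      unfolding sorted_wrt_map
      by (rule sorted_wrt_mono_rel[of _ "\<lambda>a b. (a, b) \<in> RH"]) (use A.inr_mono X assms(13) in auto)
    have x_h1: "(x, \<iota>H h1) \<in> A.RX" if "x \<in> set xs" for x
      using that A.twist_less_h1 CF_G by (auto simp: xs X)
    have h1_h: "\<iota>H h = \<iota>H h1 \<or> (\<iota>H h1, \<iota>H h) \<in> A.RX" if "h \<in> set hs" for h
      using that assms(13) A.inr_mono[of h1 h] by (auto simp: hs X)
    have h_z: "(\<iota>H h, z) \<in> A.RX" if "h \<in> set hs" for h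
      using that A.inr_less_z CF_H by (simp add: X)
    have "z \<in> A.cone" using A.z_cone by (simp add: X)
    moreover have "(x, \<iota>H h) \<in> A.RX" if "x \<in> set xs" "h \<in> set hs" for x h
      using x_h1[OF that(1)] h1_h[OF that(2)] A.RX.less_trans by metis
    moreover have "(x, z) \<in> A.RX" if "x \<in> set xs" for x
      using x_h1[OF that] h_z[of h1] hs A.RX.less_trans by auto
    ultimately show ?thesis
      using pos sub xs_sorted hs_sorted h_z by (auto simp: sorted_wrt_append)
  qed
  show ?thesis
  proof (intro exI[of _ A.RX] conjI)
    show "generate X (set xs \<union> \<iota>H ` set hs) = carrier X"
      using A.cone_generate cone_eq by (simp add: X)
    show "isolated_ordering X A.RX"
      using isolated_if_defines_isolated[OF _ defX] A.group_amalg by (simp add: X)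
    show "\<iota>G \<in> hom G X" "\<iota>H \<in> hom H X"
      using A.inl_hom A.inr_hom by (simp_all add: X)
    show "\<forall>a b. (a, b) \<in> RG \<longrightarrow> (\<iota>G a, \<iota>G b) \<in> A.RX" "\<forall>a b. (a, b) \<in> RH \<longrightarrow> (\<iota>H a, \<iota>H b) \<in> A.RX"
      using A.inl_mono A.inr_mono by (simp_all add: X)
    show "z = \<iota>H zH" using A.z_eq by (simp add: X)
    show "z \<in> positive_cone X A.RX"
      using A.z_cone A.positive_cone_RX by (simp add: X)
    show "right_invariant X A.RX z" using A.right_invariant_z by (simp add: X)
    show "ordering_rank X A.RX \<le> ordering_rank G RG + ordering_rank H RH"
      using A.rank_RX by (simp add: X)
    show "\<forall>Y. subgroup Y X \<and> Y \<noteq> {\<one>\<^bsub>X\<^esub>} \<and> Y \<noteq> carrier X \<and> order_convex X A.RX Y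
        \<longrightarrow> Y = generate X {hd xs} \<and> infinite Y"
      using A.convex_subgroup cofX by (simp add: X xs gs)
  qed (use defX independent sorted cofX in blast)+
qed

end
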